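(* Let $\mathcal F=\{F_1,\dots,F_k\}$ be a family of Finsler structures on an $n$-dimensional differentiable manifold $M$ which are independent in a neighborhood $W$ of $(x_0,y_0)\in TM$, with $F_i(x_0,y_0)=1$ for every $i=1,\dots,k$, and set $F_{\max}=\max_iF_i$. Let $(x_0,\alpha_0)\in T^*M\backslash 0$ be such that $X_{u(x_0,\alpha_0)}(x_0)=y_0$, i.e. $y_0$ is the unique maximizer of $\alpha_0$ in $S_{F_{\max}}[x_0,0,1]$. Then the extended geodesic field $\mathcal E$ of $(M,F_{\max})$ is a Lipschitz vector field in a neighborhood of $(x_0,\alpha_0)$.
   Context: A Finsler structure on a $C^\infty$ manifold $M$ is a continuous function $F:TM\to[0,\infty)$, $C^\infty$ on $TM\backslash0$, such that each $F(x,\cdot)$ is an asymmetric norm on $T_xM$ (vanishes only at $0$, $F(x,\lambda y)=\lambda F(x,y)$ for $\lambda>0$, subadditive) and $\frac12\frac{\partial^2F^2}{\partial y^i\partial y^j}$ is positive definite on $TM\backslash0$. $S_{F_{\max}}[x,0,1]=\{y\in T_xM:F_{\max}(x,y)=1\}$. The family $\mathcal F$ is independent in a neighborhood $W$ of $(x_0,y_0)$ if $\{d(F_1(x,\cdot))_y,\dots,d(F_k(x,\cdot))_y\}\subset T_x^*M$ is linearly independent for every $(x,y)\in W$, where $d(F_i(x,\cdot))_y$ is the differential of $y'\mapsto F_i(x,y')$ at $y$. Local control system near $(x_0,y_0)$: choose coordinates $\phi=(x^1,\dots,x^n)$ near $x_0$ and smooth functions $F_{k+1},\dots,F_n$ near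 $(x_0,y_0)$ in $TM$ with $F_i(x_0,y_0)=\frac12$ for $i>k$ such that $d(F_1(x_0,\cdot))_{y_0},\dots,d(F_n(x_0,\cdot))_{y_0}$ is a basis of $T_{x_0}^*M$. Then $\psi(x,y)=(x^1,\dots,x^n,F_1(x,y),\dots,F_n(x,y))$ is a coordinate system of $TM$ near $(x_0,y_0)$. For a small neighborhood $U$ of $x_0$ and small $\varepsilon\in(0,\frac12)$ let $Q=\prod_{i=1}^n(F_i(x_0,y_0)-\varepsilon,F_i(x_0,y_0)+\varepsilon)$, with $\phi(U)\times Q$ relatively compact in the image of $\psi$, let $C=Q\cap\{z\in\mathbb R^n:\max_i|z^i|=1\}$ and $X_u(x)=\psi^{-1}(x,u)$ for $u\in C$; these are smooth $F_{\max}$-unit vector fields on $U$, and $u\mapsto X_u(x)$ is a homeomorphism of $C$ onto its image in $S_{F_{\max}}[x,0,1]$. Extended geodesic field: write $X_u(x)=(f^1(x,u),\dots,f^n(x,u))$ in coordinates and, in natural coordinates $(x^i,\alpha_i)$ of $T^*U$, let $$\vec H_u(x,\alpha)=\sum_if^i(x,u)\frac{\partial}{\partial x^i}-\sum_{i,j}\alpha_j\frac{\partial f^j}{\partial x^i}(x,u)\frac{\partial}{\partial\alpha_i}$$ be the Hamiltonian vector field of $H_u(x,\alpha)=\alpha(X_u(x))$. For $(x,\alpha)$ near $(x_0,\alpha_0)$, $u(x,\alpha)\in C$ is the control such that $X_{u(x,\alpha)}(x)$ is the (unique) point of $S_{F_{\max}}[x,0,1]$ maximizing $\alpha$, and $\mathcal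 E(x,\alpha)=\vec H_{u(x,\alpha)}(x,\alpha)$. The local field $\mathcal E$ does not depend on the coordinate system or the control system chosen. "Lipschitz" refers to components in coordinates. *)

theory Defs
  imports "HOL-Analysis.Analysis"
begin

section \<open>Smooth maps between Euclidean spaces\<close>

text \<open>Meant for open sets \<open>S\<close>. In finite dimension, continuity of all directional derivatives up
  to order \<open>m\<close> is the usual class \<open>C\<^sup>m\<close>.\<close>

primrec Cm_on :: "nat \<Rightarrow> 'a::euclidean_space set \<Rightarrow> ('a \<Rightarrow> 'b::real_normed_vector) \<Rightarrow> bool" where
  "Cm_on 0 S f \<longleftrightarrow> continuous_on S f"
| "Cm_on (Suc m) S f \<longleftrightarrow> (\<forall>x\<in>S. f differentiable (at x)) \<and>
     (\<forall>v. Cm_on m S (\<lambda>x. frechet_derivative f (at x) v))"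

definition smooth_on :: "'a::euclidean_space set \<Rightarrow> ('a \<Rightarrow> 'b::real_normed_vector) \<Rightarrow> bool" where
  "smooth_on S f \<longleftrightarrow> (\<forall>m. Cm_on m S f)"

definition partial_deriv :: "'n \<Rightarrow> (real^'n \<Rightarrow> real) \<Rightarrow> real^'n \<Rightarrow> real" where
  "partial_deriv i f p = frechet_derivative f (at p) (axis i 1)"


section \<open>Smooth manifolds\<close>

text \<open>A chart is a pair of a domain and a coordinate map; the values of the coordinate map
  outside the domain are irrelevant. The manifold is the whole type \<open>'m\<close>, its dimension is
  \<open>CARD('n)\<close>, and its smooth structure is a maximal atlas \<open>A\<close>.\<close>

type_synonym ('m, 'n) chart = "'m set \<times> ('m \<Rightarrow> (real, 'n) vec)"

definition chart_inv :: "('m, 'n::finite) chart \<Rightarrow> real^'n \<Rightarrow> 'm" where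
  "chart_inv c = inv_into (fst c) (snd c)"

definition is_chart :: "('m::topological_space, 'n::finite) chart \<Rightarrow> bool" where
  "is_chart c \<longleftrightarrow> open (fst c) \<and> open (snd c ` fst c) \<and>
     homeomorphism (fst c) (snd c ` fst c) (snd c) (chart_inv c)"

definition transition :: "('m, 'n::finite) chart \<Rightarrow> ('m, 'n) chart \<Rightarrow> real^'n \<Rightarrow> real^'n" where
  "transition c d = (\<lambda>p. snd d (chart_inv c p))"

definition smooth_compatible :: "('m, 'n::finite) chart \<Rightarrow> ('m, 'n) chart \<Rightarrow> bool" where
  "smooth_compatible c d \<longleftrightarrow>
     smooth_on (snd c ` (fst c \<inter> fst d)) (transition c d) \<and>
     smooth_on (snd d ` (fst c \<inter> fst d)) (transition d c)"

definition smooth_manifold ::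
    "('m::{t2_space, second_countable_topology}, 'n::finite) chart set \<Rightarrow> bool" where
  "smooth_manifold A \<longleftrightarrow>
     (\<forall>c\<in>A. is_chart c) \<and>
     (\<Union>c\<in>A. fst c) = UNIV \<and>
     (\<forall>c\<in>A. \<forall>d\<in>A. smooth_compatible c d) \<and>
     (\<forall>c. is_chart c \<and> (\<forall>d\<in>A. smooth_compatible c d) \<longrightarrow> c \<in> A)"


section \<open>Tangent and cotangent bundle\<close>

text \<open>A tangent vector at \<open>x\<close> is the family of its component vectors in the charts around \<open>x\<close>,
  related by the derivatives of the coordinate changes. It is set to \<open>0\<close> at all other charts, so
  that equality of tangent vectors is equality of functions.\<close>

type_synonym ('m, 'n) tvec = "('m, 'n) chart \<Rightarrow> (real, 'n) vec"
type_synonym ('m, 'n) covec = "('m, 'n) tvec \<Rightarrow> real"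

definition tangent_space :: "('m, 'n::finite) chart set \<Rightarrow> 'm \<Rightarrow> ('m, 'n) tvec set" where
  "tangent_space A x = {v.
     (\<forall>c. \<not> (c \<in> A \<and> x \<in> fst c) \<longrightarrow> v c = 0) \<and>
     (\<forall>c\<in>A. \<forall>d\<in>A. x \<in> fst c \<and> x \<in> fst d \<longrightarrow>
        v d = frechet_derivative (transition c d) (at (snd c x)) (v c))}"

text \<open>The tangent vector \<open>\<Sum>\<^sub>i w\<^sup>i \<partial>/\<partial>x\<^sup>i\<close> at \<open>x\<close>, for the coordinates given by \<open>c\<close>.\<close>

definition tangent_of ::
    "('m, 'n::finite) chart set \<Rightarrow> ('m, 'n) chart \<Rightarrow> 'm \<Rightarrow> real^'n \<Rightarrow> ('m, 'n) tvec" where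
  "tangent_of A c x w = (\<lambda>d. if d \<in> A \<and> x \<in> fst d
     then frechet_derivative (transition c d) (at (snd c x)) w else 0)"

definition tangent_bundle :: "('m, 'n::finite) chart set \<Rightarrow> ('m \<times> ('m, 'n) tvec) set" where
  "tangent_bundle A = {(x, v). v \<in> tangent_space A x}"

definition slit_tangent_bundle :: "('m, 'n::finite) chart set \<Rightarrow> ('m \<times> ('m, 'n) tvec) set" where
  "slit_tangent_bundle A = {(x, v). v \<in> tangent_space A x \<and> v \<noteq> (\<lambda>_. 0)}"

definition tb_coords ::
    "('m, 'n::finite) chart \<Rightarrow> 'm \<times> ('m, 'n) tvec \<Rightarrow> (real^'n) \<times> (real^'n)" where
  "tb_coords c = (\<lambda>(x, v). (snd c x, v c))"

definition tb_coords_inv ::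
    "('m, 'n::finite) chart set \<Rightarrow> ('m, 'n) chart \<Rightarrow> (real^'n) \<times> (real^'n)
      \<Rightarrow> 'm \<times> ('m, 'n) tvec" where
  "tb_coords_inv A c = (\<lambda>(p, w). (chart_inv c p, tangent_of A c (chart_inv c p) w))"

text \<open>\<open>over c\<close> is the preimage of the chart domain under the projection of either bundle.\<close>

definition over :: "('m, 'n) chart \<Rightarrow> ('m \<times> 'v) set" where
  "over c = fst c \<times> UNIV"

definition tb_open :: "('m, 'n::finite) chart set \<Rightarrow> ('m \<times> ('m, 'n) tvec) set \<Rightarrow> bool" where
  "tb_open A V \<longleftrightarrow> V \<subseteq> tangent_bundle A \<and> (\<forall>c\<in>A. open (tb_coords c ` (V \<inter> over c)))"

definition tb_continuous ::
    "('m, 'n::finite) chart set \<Rightarrow> ('m \<times> ('m, 'n) tvec \<Rightarrow> 'b::topological_space) \<Rightarrow> bool" where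
  "tb_continuous A G \<longleftrightarrow>
     (\<forall>c\<in>A. continuous_on (snd c ` fst c \<times> UNIV) (\<lambda>z. G (tb_coords_inv A c z)))"

definition tb_smooth_on ::
    "('m, 'n::finite) chart set \<Rightarrow> ('m \<times> ('m, 'n) tvec) set
      \<Rightarrow> ('m \<times> ('m, 'n) tvec \<Rightarrow> 'b::real_normed_vector) \<Rightarrow> bool" where
  "tb_smooth_on A V G \<longleftrightarrow>
     (\<forall>c\<in>A. smooth_on (tb_coords c ` (V \<inter> over c)) (\<lambda>z. G (tb_coords_inv A c z)))"

text \<open>A coordinate system on the manifold \<open>TM\<close> with domain \<open>V\<close>.\<close>

definition tb_coordinate_system ::
    "('m, 'n::finite) chart set \<Rightarrow> ('m \<times> ('m, 'n) tvec) set
      \<Rightarrow> ('m \<times> ('m, 'n) tvec \<Rightarrow> (real^'n) \<times> (real^'n)) \<Rightarrow> bool" where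
  "tb_coordinate_system A V \<psi> \<longleftrightarrow>
     tb_open A V \<and> inj_on \<psi> V \<and> open (\<psi> ` V) \<and> tb_smooth_on A V \<psi> \<and>
     (\<forall>d\<in>A. smooth_on (\<psi> ` (V \<inter> over d)) (\<lambda>z. tb_coords d (inv_into V \<psi> z)))"

text \<open>Covectors at \<open>x\<close> are the linear functionals on \<open>T\<^sub>xM\<close>, extended by \<open>0\<close> outside \<open>T\<^sub>xM\<close>.\<close>

definition cotangent_space :: "('m, 'n::finite) chart set \<Rightarrow> 'm \<Rightarrow> ('m, 'n) covec set" where
  "cotangent_space A x = {\<alpha>.
     (\<forall>v\<in>tangent_space A x. \<forall>w\<in>tangent_space A x. \<alpha> (\<lambda>c. v c + w c) = \<alpha> v + \<alpha> w) \<and>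
     (\<forall>r. \<forall>v\<in>tangent_space A x. \<alpha> (\<lambda>c. r *\<^sub>R v c) = r * \<alpha> v) \<and>
     (\<forall>v. v \<notin> tangent_space A x \<longrightarrow> \<alpha> v = 0)}"

definition cotangent_bundle :: "('m, 'n::finite) chart set \<Rightarrow> ('m \<times> ('m, 'n) covec) set" where
  "cotangent_bundle A = {(x, \<alpha>). \<alpha> \<in> cotangent_space A x}"

text \<open>The natural coordinates \<open>(x\<^sup>i, \<alpha>\<^sub>i)\<close>, where \<open>\<alpha>\<^sub>i = \<alpha>(\<partial>/\<partial>x\<^sup>i)\<close>.\<close>

definition ctb_coords ::
    "('m, 'n::finite) chart set \<Rightarrow> ('m, 'n) chart \<Rightarrow> 'm \<times> ('m, 'n) covec
      \<Rightarrow> (real^'n) \<times> (real^'n)" where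
  "ctb_coords A c = (\<lambda>(x, \<alpha>). (snd c x, \<chi> i. \<alpha> (tangent_of A c x (axis i 1))))"

definition ctb_coords_inv ::
    "('m, 'n::finite) chart set \<Rightarrow> ('m, 'n) chart \<Rightarrow> (real^'n) \<times> (real^'n)
      \<Rightarrow> 'm \<times> ('m, 'n) covec" where
  "ctb_coords_inv A c = (\<lambda>(p, a). (chart_inv c p,
     \<lambda>v. if v \<in> tangent_space A (chart_inv c p) then \<Sum>i\<in>UNIV. a $ i * v c $ i else 0))"

definition ctb_open :: "('m, 'n::finite) chart set \<Rightarrow> ('m \<times> ('m, 'n) covec) set \<Rightarrow> bool" where
  "ctb_open A N \<longleftrightarrow> N \<subseteq> cotangent_bundle A \<and>
     (\<forall>c\<in>A. open (ctb_coords A c ` (N \<inter> over c)))"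

text \<open>The differential \<open>d(G(x,\<cdot>))\<^sub>v \<in> T\<^sub>x\<^sup>*M\<close> of the restriction of \<open>G\<close> to the fibre \<open>T\<^sub>xM\<close>, to be
  used where \<open>G\<close> is smooth near \<open>(x, v)\<close>.\<close>

definition fibre_differential ::
    "('m, 'n::finite) chart set \<Rightarrow> ('m \<times> ('m, 'n) tvec \<Rightarrow> real)
      \<Rightarrow> 'm \<Rightarrow> ('m, 'n) tvec \<Rightarrow> ('m, 'n) covec" where
  "fibre_differential A G x v = (\<lambda>w. if w \<in> tangent_space A x
     then deriv (\<lambda>t. G (x, \<lambda>c. v c + t *\<^sub>R w c)) 0 else 0)"

definition covecs_independent :: "'i set \<Rightarrow> ('i \<Rightarrow> ('m, 'n) covec) \<Rightarrow> bool" where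
  "covecs_independent I \<omega> \<longleftrightarrow>
     (\<forall>r. (\<forall>w. (\<Sum>i\<in>I. r i * \<omega> i w) = 0) \<longrightarrow> (\<forall>i\<in>I. r i = 0))"

definition cotangent_basis ::
    "('m, 'n::finite) chart set \<Rightarrow> 'm \<Rightarrow> 'i set \<Rightarrow> ('i \<Rightarrow> ('m, 'n) covec) \<Rightarrow> bool" where
  "cotangent_basis A x I \<omega> \<longleftrightarrow>
     (\<forall>i\<in>I. \<omega> i \<in> cotangent_space A x) \<and> covecs_independent I \<omega> \<and>
     (\<forall>\<beta>\<in>cotangent_space A x. \<exists>r. \<beta> = (\<lambda>w. \<Sum>i\<in>I. r i * \<omega> i w))"


section \<open>Finsler structures\<close>

text \<open>The matrix \<open>(1/2) \<partial>\<^sup>2F\<^sup>2/\<partial>y\<^sup>i\<partial>y\<^sup>j\<close> at \<open>(x, v)\<close>, in the coordinates given by \<open>c\<close>.\<close>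

definition fundamental_tensor ::
    "('m, 'n::finite) chart set \<Rightarrow> ('m \<times> ('m, 'n) tvec \<Rightarrow> real)
      \<Rightarrow> ('m, 'n) chart \<Rightarrow> 'm \<Rightarrow> ('m, 'n) tvec \<Rightarrow> real^'n^'n" where
  "fundamental_tensor A F c x v = (\<chi> i j. 1/2 *
     partial_deriv i (partial_deriv j (\<lambda>y. (F (x, tangent_of A c x y))\<^sup>2)) (v c))"

definition finsler_structure ::
    "('m, 'n::finite) chart set \<Rightarrow> ('m \<times> ('m, 'n) tvec \<Rightarrow> real) \<Rightarrow> bool" where
  "finsler_structure A F \<longleftrightarrow>
     tb_continuous A F \<and>
     tb_smooth_on A (slit_tangent_bundle A) F \<and>
     (\<forall>x. \<forall>v\<in>tangent_space A x. F (x, v) \<ge> 0 \<and> (F (x, v) = 0 \<longleftrightarrow> v = (\<lambda>_. 0))) \<and>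
     (\<forall>x. \<forall>v\<in>tangent_space A x. \<forall>r>0. F (x, \<lambda>c. r *\<^sub>R v c) = r * F (x, v)) \<and>
     (\<forall>x. \<forall>v\<in>tangent_space A x. \<forall>w\<in>tangent_space A x.
        F (x, \<lambda>c. v c + w c) \<le> F (x, v) + F (x, w)) \<and>
     (\<forall>(x, v)\<in>slit_tangent_bundle A. \<forall>c\<in>A. x \<in> fst c \<longrightarrow>
        (\<forall>w. w \<noteq> 0 \<longrightarrow> w \<bullet> (fundamental_tensor A F c x v *v w) > 0))"

definition F_max :: "(nat \<Rightarrow> 'p \<Rightarrow> real) \<Rightarrow> nat \<Rightarrow> 'p \<Rightarrow> real" where
  "F_max F k = (\<lambda>p. Max ((\<lambda>i. F i p) ` {1..k}))"

definition unit_sphere ::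
    "('m, 'n::finite) chart set \<Rightarrow> ('m \<times> ('m, 'n) tvec \<Rightarrow> real) \<Rightarrow> 'm \<Rightarrow> ('m, 'n) tvec set" where
  "unit_sphere A F x = {v \<in> tangent_space A x. F (x, v) = 1}"

text \<open>The differentials make sense only off the zero section, hence \<open>W \<subseteq> TM \ 0\<close>.\<close>

definition independent_family_on ::
    "('m, 'n::finite) chart set \<Rightarrow> (nat \<Rightarrow> 'm \<times> ('m, 'n) tvec \<Rightarrow> real) \<Rightarrow> nat
      \<Rightarrow> ('m \<times> ('m, 'n) tvec) set \<Rightarrow> bool" where
  "independent_family_on A F k W \<longleftrightarrow> W \<subseteq> slit_tangent_bundle A \<and>
     (\<forall>(x, v)\<in>W. covecs_independent {1..k} (\<lambda>i. fibre_differential A (F i) x v))"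

definition unique_maximizer :: "'v set \<Rightarrow> ('v \<Rightarrow> real) \<Rightarrow> 'v \<Rightarrow> bool" where
  "unique_maximizer S \<alpha> v \<longleftrightarrow> v \<in> S \<and> (\<forall>w\<in>S. w \<noteq> v \<longrightarrow> \<alpha> w < \<alpha> v)"


section \<open>Local control systems and the extended geodesic field\<close>

text \<open>The functions \<open>F\<^sub>1, \<dots>, F\<^sub>n\<close> are numbered by \<open>{1..n}\<close>, whereas coordinates in \<open>\<real>\<^sup>n\<close> are indexed by
  the type \<open>'n\<close>; the bijection \<open>e\<close> from \<open>'n\<close> onto \<open>{1..n}\<close> translates between the two.\<close>

definition psi ::
    "('m, 'n::finite) chart \<Rightarrow> ('n \<Rightarrow> nat) \<Rightarrow> (nat \<Rightarrow> 'm \<times> ('m, 'n) tvec \<Rightarrow> real)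
      \<Rightarrow> 'm \<times> ('m, 'n) tvec \<Rightarrow> (real^'n) \<times> (real^'n)" where
  "psi c e G = (\<lambda>(x, v). (snd c x, \<chi> j. G (e j) (x, v)))"

definition control_cube ::
    "('n::finite \<Rightarrow> nat) \<Rightarrow> (nat \<Rightarrow> 'p \<Rightarrow> real) \<Rightarrow> 'p \<Rightarrow> real \<Rightarrow> (real^'n) set" where
  "control_cube e G p0 \<epsilon> =
     {z. \<forall>j. G (e j) p0 - \<epsilon> < z $ j \<and> z $ j < G (e j) p0 + \<epsilon>}"

definition control_set ::
    "('n::finite \<Rightarrow> nat) \<Rightarrow> (nat \<Rightarrow> 'p \<Rightarrow> real) \<Rightarrow> 'p \<Rightarrow> real \<Rightarrow> (real^'n) set" where
  "control_set e G p0 \<epsilon> =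
     control_cube e G p0 \<epsilon> \<inter> {z. Max ((\<lambda>j. \<bar>z $ j\<bar>) ` UNIV) = 1}"

text \<open>\<open>G 1, \<dots>, G n\<close> is the extended family of functions, \<open>V\<close> is the domain of the coordinate
  system \<open>\<psi>\<close>.\<close>

definition local_control_system ::
    "('m::topological_space, 'n::finite) chart set \<Rightarrow> (nat \<Rightarrow> 'm \<times> ('m, 'n) tvec \<Rightarrow> real) \<Rightarrow> nat
      \<Rightarrow> 'm \<Rightarrow> ('m, 'n) tvec
      \<Rightarrow> ('m, 'n) chart \<Rightarrow> ('n \<Rightarrow> nat) \<Rightarrow> (nat \<Rightarrow> 'm \<times> ('m, 'n) tvec \<Rightarrow> real)
      \<Rightarrow> ('m \<times> ('m, 'n) tvec) set \<Rightarrow> 'm set \<Rightarrow> real \<Rightarrow> bool" where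
  "local_control_system A F k x0 y0 c e G V U \<epsilon> \<longleftrightarrow>
     c \<in> A \<and> x0 \<in> fst c \<and>
     bij_betw e UNIV {1..CARD('n)} \<and>
     (\<forall>i\<in>{1..k}. G i = F i) \<and>
     (\<forall>i\<in>{k<..CARD('n)}. tb_smooth_on A V (G i) \<and> G i (x0, y0) = 1/2) \<and>
     cotangent_basis A x0 {1..CARD('n)} (\<lambda>i. fibre_differential A (G i) x0 y0) \<and>
     (x0, y0) \<in> V \<and> V \<subseteq> over c \<and> tb_coordinate_system A V (psi c e G) \<and>
     open U \<and> x0 \<in> U \<and> U \<subseteq> fst c \<and>
     0 < \<epsilon> \<and> \<epsilon> < 1/2 \<and>
     compact (closure (snd c ` U \<times> control_cube e G (x0, y0) \<epsilon>)) \<and>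
     closure (snd c ` U \<times> control_cube e G (x0, y0) \<epsilon>) \<subseteq> psi c e G ` V"

text \<open>The vector field \<open>X\<^sub>u\<close>, for a control \<open>u\<close>.\<close>

definition control_field ::
    "('m, 'n::finite) chart \<Rightarrow> ('n \<Rightarrow> nat) \<Rightarrow> (nat \<Rightarrow> 'm \<times> ('m, 'n) tvec \<Rightarrow> real)
      \<Rightarrow> ('m \<times> ('m, 'n) tvec) set \<Rightarrow> real^'n \<Rightarrow> 'm \<Rightarrow> ('m, 'n) tvec" where
  "control_field c e G V u x = snd (inv_into V (psi c e G) (snd c x, u))"

text \<open>Components, in the natural coordinates of the cotangent bundle, of the Hamiltonian vector
  field of \<open>\<alpha> \<mapsto> \<alpha>(X(x))\<close>, for a vector field \<open>X\<close> with coordinate expression \<open>f\<close>.\<close>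

definition hamiltonian_lift ::
    "('m, 'n::finite) chart \<Rightarrow> ('m \<Rightarrow> ('m, 'n) tvec)
      \<Rightarrow> (real^'n) \<times> (real^'n) \<Rightarrow> (real^'n) \<times> (real^'n)" where
  "hamiltonian_lift c X = (\<lambda>(p, a).
     let f = (\<lambda>q. X (chart_inv c q) c) in
     (f p, \<chi> i. - (\<Sum>j\<in>UNIV. a $ j * partial_deriv i (\<lambda>q. f q $ j) p)))"

text \<open>\<open>u\<close> is a control \<open>u(x, \<alpha>)\<close>; \<open>Fm\<close> stands for the maximum of the Finsler structures.\<close>

definition is_maximizing_control ::
    "('m, 'n::finite) chart set \<Rightarrow> ('m \<times> ('m, 'n) tvec \<Rightarrow> real)
      \<Rightarrow> ('m, 'n) chart \<Rightarrow> ('n \<Rightarrow> nat) \<Rightarrow> (nat \<Rightarrow> 'm \<times> ('m, 'n) tvec \<Rightarrow> real)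
      \<Rightarrow> ('m \<times> ('m, 'n) tvec) set \<Rightarrow> (real^'n) set
      \<Rightarrow> 'm \<Rightarrow> ('m, 'n) covec \<Rightarrow> real^'n \<Rightarrow> bool" where
  "is_maximizing_control A Fm c e G V C x \<alpha> u \<longleftrightarrow>
     u \<in> C \<and> unique_maximizer (unit_sphere A Fm x) \<alpha> (control_field c e G V u x)"

text \<open>The components of the extended geodesic field at \<open>(x, \<alpha>)\<close> in the natural coordinates of the
  cotangent bundle given by \<open>c\<close>; meaningful where the maximizing control exists and is unique.\<close>

definition extended_geodesic_field ::
    "('m, 'n::finite) chart set \<Rightarrow> ('m \<times> ('m, 'n) tvec \<Rightarrow> real)
      \<Rightarrow> ('m, 'n) chart \<Rightarrow> ('n \<Rightarrow> nat) \<Rightarrow> (nat \<Rightarrow> 'm \<times> ('m, 'n) tvec \<Rightarrow> real)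
      \<Rightarrow> ('m \<times> ('m, 'n) tvec) set \<Rightarrow> (real^'n) set
      \<Rightarrow> 'm \<times> ('m, 'n) covec \<Rightarrow> (real^'n) \<times> (real^'n)" where
  "extended_geodesic_field A Fm c e G V C = (\<lambda>(x, \<alpha>).
     let u = (THE u. is_maximizing_control A Fm c e G V C x \<alpha> u) in
     hamiltonian_lift c (control_field c e G V u) (ctb_coords A c (x, \<alpha>)))"

text \<open>A vector field on \<open>N \<subseteq> T\<^sup>*M\<close>, given by its components in the natural coordinates of \<open>c\<close>.\<close>

definition lipschitz_field_on ::
    "('m, 'n::finite) chart set \<Rightarrow> ('m, 'n) chart \<Rightarrow> ('m \<times> ('m, 'n) covec) set
      \<Rightarrow> ('m \<times> ('m, 'n) covec \<Rightarrow> (real^'n) \<times> (real^'n)) \<Rightarrow> bool" where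
  "lipschitz_field_on A c N E \<longleftrightarrow>
     (\<exists>L. L-lipschitz_on (ctb_coords A c ` N) (\<lambda>z. E (ctb_coords_inv A c z)))"

end

theory Submission
  imports Defs
begin

text \<open>Write \<open>X\<^sub>u(x) = f(x, u)\<close> in coordinates. In the coordinates \<open>u\<^sub>i = F\<^sub>i(x, y)\<close> the unit ball of
  \<open>F\<^sub>m\<^sub>a\<^sub>x\<close> is locally \<open>{u. u\<^sub>i \<le> 1 for i \<le> k}\<close>, which does not depend on \<open>x\<close>. Let \<open>u\<close> and \<open>u'\<close> be the
  maximizing controls at \<open>(x, \<alpha>)\<close> and \<open>(x', \<alpha>')\<close>. Then \<open>f(x, u')\<close> is feasible at \<open>x\<close>, and strong convexity
  of the \<open>F\<^sub>i\<^sup>2\<close> along the fibres together with homogeneity yields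
  \<open>\<alpha> f(x, u) - \<alpha> f(x, u') \<ge> b |u - u'|\<^sup>2\<close> for some \<open>b > 0\<close>. Adding the same inequality with the two points
  exchanged, and bounding the mixed difference of the smooth function \<open>(x, \<alpha>, u) \<mapsto> \<alpha> f(x, u)\<close>, gives
  \<open>2 b |u - u'|\<^sup>2 \<le> L |(x, \<alpha>) - (x', \<alpha>')| |u - u'|\<close>. So the control is Lipschitz, and \<open>\<E>\<close> is a smooth
  function of \<open>(x, \<alpha>)\<close> and the control.\<close>

section \<open>Calculus of smooth maps\<close>

text \<open>The obstacle is that the maximum is not smooth. The set of indices with
  \<open>u_i = 1\<close> at the maximizer may change with \<open>(x, \<alpha>)\<close>, so the
  maximizer cannot be followed by an implicit function theorem; two-point inequalities replace
  differentiation. Comparing optimal values alone would bound \<open>|u - u'|^2\<close> by the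
  perturbation and yield only exponent 1/2. The mixed difference carries a factor
  \<open>|u - u'|\<close> of its own, and cancelling it restores exponent 1. Transport at fixed
  \<open>u\<close> makes the comparison exact: a maximizer moved to the other base point is feasible
  there without any error term. The quadratic gain has to be uniform, but convexity is available
  only locally: positivity of the Hessians at \<open>(x0, y0)\<close> is spread over a neighbourhood
  by compactness. A second compactness argument therefore confines every maximizer to that
  neighbourhood. The gain is also proportional to the maximal value, which is kept above half of
  \<open>\<alpha>0 y0\<close>; this number is positive because \<open>\<alpha>0\<close> is not
  zero.\<close>

lemma Cm_on_cong:
  assumes "open S" "\<And>x. x \<in> S \<Longrightarrow> f x = g x" "Cm_on m S f"
  shows "Cm_on m S g"
  using assms(2,3)
proof (induction m arbitrary: f g)
  case 0
  then show ?case by (simp cong: continuous_on_cong)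
next
  case (Suc m)
  have d: "g differentiable (at x) \<and> frechet_derivative g (at x) = frechet_derivative f (at x)"
    if "x \<in> S" for x
  proof -
    have "(f has_derivative frechet_derivative f (at x)) (at x)"
      using Suc.prems(2) that frechet_derivative_works by auto
    then have "(g has_derivative frechet_derivative f (at x)) (at x)"
      by (rule has_derivative_transform_within_open[OF _ assms(1) that]) (use Suc.prems(1) in auto)
    then show ?thesis
      using frechet_derivative_at differentiable_def by metis
  qed
  have "Cm_on m S (\<lambda>x. frechet_derivative g (at x) v)" for v
    by (rule Suc.IH[where f="\<lambda>x. frechet_derivative f (at x) v"]) (use d Suc.prems(2) in auto)
  with d show ?case by simp
qed

lemma Cm_on_Suc_has_derivative:
  assumes "Cm_on (Suc m) S f" "x \<in> S"
  shows "(f has_derivative frechet_derivative f (at x)) (at x)"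
  using assms frechet_derivative_works by auto

lemma Cm_on_SucD: "Cm_on (Suc m) S f \<Longrightarrow> Cm_on m S f"
proof (induction m arbitrary: f)
  case 0
  then show ?case
    by (simp add: differentiable_at_imp_differentiable_on differentiable_imp_continuous_on)
next
  case (Suc m)
  then show ?case by (metis Cm_on.simps(2))
qed

lemma Cm_on_add:
  assumes "open S"
  shows "Cm_on m S f \<Longrightarrow> Cm_on m S g \<Longrightarrow> Cm_on m S (\<lambda>x. f x + g x)"
proof (induction m arbitrary: f g)
  case 0
  then show ?case by (auto intro: continuous_intros)
next
  case (Suc m)
  have d: "((\<lambda>x. f x + g x) has_derivative
      (\<lambda>v. frechet_derivative f (at x) v + frechet_derivative g (at x) v)) (at x)" if "x \<in> S" for x
    using Suc.prems that by (intro has_derivative_add Cm_on_Suc_has_derivative)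
  have "Cm_on m S (\<lambda>x. frechet_derivative (\<lambda>x. f x + g x) (at x) v)" for v
    by (rule Cm_on_cong[OF assms, of "\<lambda>x. frechet_derivative f (at x) v + frechet_derivative g (at x) v"])
      (use Suc frechet_derivative_at[OF d] in \<open>auto dest: fun_cong\<close>)
  moreover have "\<forall>x\<in>S. (\<lambda>x. f x + g x) differentiable (at x)"
    using d differentiable_def by blast
  ultimately show ?case by simp
qed

text \<open>The product rule makes the derivative a sum of products, each pairing a derivative with
  an undifferentiated factor. \<open>Cm_on_SucD\<close> lowers the latter by one order, so the
  induction closes.\<close>

lemma Cm_on_mult:
  fixes f g :: "'a::euclidean_space \<Rightarrow> real"
  assumes "open S"
  shows "Cm_on m S f \<Longrightarrow> Cm_on m S g \<Longrightarrow> Cm_on m S (\<lambda>x. f x * g x)"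
proof (induction m arbitrary: f g)
  case 0
  then show ?case by (auto intro: continuous_intros)
next
  case (Suc m)
  have d: "((\<lambda>x. f x * g x) has_derivative
      (\<lambda>v. f x * frechet_derivative g (at x) v + frechet_derivative f (at x) v * g x)) (at x)"
    if "x \<in> S" for x
    using Suc.prems that by (intro has_derivative_mult Cm_on_Suc_has_derivative)
  have "Cm_on m S (\<lambda>x. frechet_derivative (\<lambda>x. f x * g x) (at x) v)" for v
    by (rule Cm_on_cong[OF assms, of
          "\<lambda>x. f x * frechet_derivative g (at x) v + frechet_derivative f (at x) v * g x"])
      (use Suc frechet_derivative_at[OF d] Cm_on_SucD[OF Suc.prems(1)] Cm_on_SucD[OF Suc.prems(2)]
        in \<open>auto dest: fun_cong intro!: Cm_on_add[OF assms]\<close>)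
  moreover have "\<forall>x\<in>S. (\<lambda>x. f x * g x) differentiable (at x)"
    using d differentiable_def by blast
  ultimately show ?case by simp
qed

lemma Cm_on_bounded_linear:
  assumes "open S" "bounded_linear L"
  shows "Cm_on m S f \<Longrightarrow> Cm_on m S (\<lambda>x. L (f x))"
proof (induction m arbitrary: f)
  case 0
  then show ?case
    using bounded_linear.continuous_on[OF assms(2)] by auto
next
  case (Suc m)
  have d: "((\<lambda>x. L (f x)) has_derivative (\<lambda>v. L (frechet_derivative f (at x) v))) (at x)"
    if "x \<in> S" for x
    using Suc.prems that by (intro bounded_linear.has_derivative[OF assms(2)] Cm_on_Suc_has_derivative)
  have "Cm_on m S (\<lambda>x. frechet_derivative (\<lambda>x. L (f x)) (at x) v)" for v
    by (rule Cm_on_cong[OF assms(1), of "\<lambda>x. L (frechet_derivative f (at x) v)"])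
      (use Suc frechet_derivative_at[OF d] in \<open>auto dest: fun_cong\<close>)
  moreover have "\<forall>x\<in>S. (\<lambda>x. L (f x)) differentiable (at x)"
    using d differentiable_def by blast
  ultimately show ?case by simp
qed

section \<open>Smoothness of all orders, and Lipschitz bounds on compact convex sets\<close>

lemma smooth_on_imp_continuous_on: "smooth_on S f \<Longrightarrow> continuous_on S f"
  unfolding smooth_on_def by (metis Cm_on.simps(1))

lemma smooth_on_has_derivative:
  "smooth_on S f \<Longrightarrow> x \<in> S \<Longrightarrow> (f has_derivative frechet_derivative f (at x)) (at x)"
  unfolding smooth_on_def using Cm_on_Suc_has_derivative by blast

lemma smooth_on_frechet_derivative:
  "smooth_on S f \<Longrightarrow> smooth_on S (\<lambda>x. frechet_derivative f (at x) v)"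
  unfolding smooth_on_def by (metis Cm_on.simps(2))

lemma smooth_on_mult:
  fixes f g :: "'a::euclidean_space \<Rightarrow> real"
  shows "open S \<Longrightarrow> smooth_on S f \<Longrightarrow> smooth_on S g \<Longrightarrow> smooth_on S (\<lambda>x. f x * g x)"
  unfolding smooth_on_def by (blast intro: Cm_on_mult)

lemma smooth_on_bounded_linear:
  "open S \<Longrightarrow> bounded_linear L \<Longrightarrow> smooth_on S f \<Longrightarrow> smooth_on S (\<lambda>x. L (f x))"
  unfolding smooth_on_def by (blast intro: Cm_on_bounded_linear)

lemma smooth_on_subset: 
  assumes "T \<subseteq> S" "smooth_on S f"
  shows "smooth_on T f"
proof -
  have "Cm_on m S f \<Longrightarrow> Cm_on m T f" for m
    by (induction m arbitrary: f) (use assms(1) continuous_on_subset in auto)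
  then show ?thesis using assms(2) unfolding smooth_on_def by blast
qed

text \<open>Smoothness supplies continuity of each directional derivative separately, so the
  operator norm is controlled by the sum over the basis vectors. That sum is bounded on the compact
  set, and convexity allows the mean value inequality.\<close>

lemma smooth_on_lipschitz:
  fixes f :: "'a::euclidean_space \<Rightarrow> 'b::real_normed_vector"
  assumes "smooth_on S f" "T \<subseteq> S" "compact T" "convex T"
  obtains L where "L > 0" "\<And>x y. x \<in> T \<Longrightarrow> y \<in> T \<Longrightarrow> norm (f x - f y) \<le> L * norm (x - y)"
proof -
  let ?D = "\<lambda>x. frechet_derivative f (at x)"
  have "continuous_on T (\<lambda>x. \<Sum>b\<in>Basis. norm (?D x b))"
    by (intro continuous_intros continuous_on_subset[OF _ assms(2)]
        smooth_on_imp_continuous_on smooth_on_frechet_derivative assms(1))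
  then have "bounded ((\<lambda>x. \<Sum>b\<in>Basis. norm (?D x b)) ` T)"
    using assms(3) compact_continuous_image compact_imp_bounded by blast
  then obtain B where B: "B > 0" "\<And>x. x \<in> T \<Longrightarrow> norm (\<Sum>b\<in>Basis. norm (?D x b)) \<le> B"
    unfolding bounded_pos by auto
  have "norm (f x - f y) \<le> B * norm (x - y)" if "x \<in> T" "y \<in> T" for x y
  proof (rule differentiable_bound[OF assms(4) _ _ that])
    fix z assume z: "z \<in> T"
    have d: "(f has_derivative ?D z) (at z)"
      using z assms smooth_on_has_derivative by blast
    then show "(f has_derivative ?D z) (at z within T)"
      using has_derivative_at_withinI by blast
    show "onorm (?D z) \<le> B"
      using onorm_componentwise[OF has_derivative_bounded_linear[OF d]] B(2)[OF z] by simp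
  qed
  with B(1) that show ?thesis by blast
qed

text \<open>The mean value inequality is applied to \<open>u \<mapsto> f (p, u) - f (p', u)\<close>.
  Its derivative is a difference of vertical derivatives of \<open>f\<close> at two base points,
  hence of size \<open>L * norm (p - p')\<close>. The product of two distances is what later lets
  one factor cancel.\<close>

lemma smooth_on_mixed_difference:
  fixes f :: "'a::euclidean_space \<times> 'b::euclidean_space \<Rightarrow> 'c::real_normed_vector"
  assumes f: "smooth_on S f" and sub: "P \<times> Q \<subseteq> S"
    and P: "compact P" "convex P" and Q: "compact Q" "convex Q"
  obtains L where "L > 0"
    "\<And>p p' u u'. \<lbrakk>p \<in> P; p' \<in> P; u \<in> Q; u' \<in> Q\<rbrakk> \<Longrightarrow>
      norm ((f (p, u) - f (p, u')) - (f (p', u) - f (p', u'))) \<le> L * norm (p - p') * norm (u - u')"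
proof -
  let ?D = "\<lambda>z. frechet_derivative f (at z)"
  have "\<exists>L. L > 0 \<and> (\<forall>x\<in>P\<times>Q. \<forall>y\<in>P\<times>Q. norm (?D x (0,b) - ?D y (0,b)) \<le> L * norm (x - y))" for b
    by (rule smooth_on_lipschitz[OF smooth_on_frechet_derivative[OF f, of "(0,b)"] sub])
      (use P Q compact_Times convex_Times in auto)
  then obtain l where l: "\<And>b. l b > 0" "\<And>b x y. x \<in> P \<times> Q \<Longrightarrow> y \<in> P \<times> Q \<Longrightarrow>
      norm (?D x (0,b) - ?D y (0,b)) \<le> l b * norm (x - y)"
    by metis
  define L where "L = (\<Sum>b\<in>Basis. l b)"
  have "L > 0" unfolding L_def by (rule sum_pos) (use l in auto)
  moreover have "norm ((f (p, u) - f (p, u')) - (f (p', u) - f (p', u'))) \<le> L * norm (p - p') * norm (u - u')"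
    if pu: "p \<in> P" "p' \<in> P" "u \<in> Q" "u' \<in> Q" for p p' u u'
  proof -
    have der: "((\<lambda>u. f (p, u) - f (p', u)) has_derivative
        (\<lambda>v. ?D (p, q) (0, v) - ?D (p', q) (0, v))) (at q)" if "q \<in> Q" for q
    proof -
      have "((\<lambda>u. f (r, u)) has_derivative (\<lambda>v. ?D (r, q) (0, v))) (at q)" if "r \<in> P" for r
      proof (rule has_derivative_compose[of "\<lambda>u. (r,u)" "\<lambda>v. (0,v)" q UNIV f])
        show "((\<lambda>u. (r, u)) has_derivative (\<lambda>v. (0, v))) (at q)"
          by (intro has_derivative_Pair has_derivative_const has_derivative_ident)
        show "(f has_derivative ?D (r, q)) (at (r, q))"
          using that \<open>q \<in> Q\<close> sub by (intro smooth_on_has_derivative[OF f]) auto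
      qed
      then show ?thesis using pu by (intro has_derivative_diff) auto
    qed
    have "norm ((f (p, u) - f (p', u)) - (f (p, u') - f (p', u'))) \<le> L * norm (p - p') * norm (u - u')"
    proof (rule differentiable_bound[OF Q(2) _ _ pu(3,4)])
      fix q assume q: "q \<in> Q"
      show "((\<lambda>u. f (p, u) - f (p', u)) has_derivative
        (\<lambda>v. ?D (p, q) (0, v) - ?D (p', q) (0, v))) (at q within Q)"
        using der[OF q] has_derivative_at_withinI by blast
      have "onorm (\<lambda>v. ?D (p, q) (0, v) - ?D (p', q) (0, v))
          \<le> (\<Sum>b\<in>Basis. norm (?D (p, q) (0, b) - ?D (p', q) (0, b)))"
        by (rule onorm_componentwise[OF has_derivative_bounded_linear[OF der[OF q]]])
      also have "\<dots> \<le> (\<Sum>b\<in>Basis. l b * norm (p - p'))"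
      proof (rule sum_mono)
        fix b :: 'b
        show "norm (?D (p, q) (0, b) - ?D (p', q) (0, b)) \<le> l b * norm (p - p')"
          using l(2)[of "(p,q)" "(p',q)" b] pu q by (simp add: norm_Pair)
      qed
      finally show "onorm (\<lambda>v. ?D (p, q) (0, v) - ?D (p', q) (0, v)) \<le> L * norm (p - p')"
        by (simp add: L_def sum_distrib_right)
    qed
    then show ?thesis by (simp add: algebra_simps)
  qed
  ultimately show ?thesis using that by blast
qed

section \<open>Convexity along fibres\<close>

lemma vec_axis_expansion: "(v::real^'n) = (\<Sum>i\<in>UNIV. v $ i *\<^sub>R axis i 1)"
  using basis_expansion[of v] by (simp add: scalar_mult_eq_scaleR)

lemma bounded_linear_axis_sum:
  assumes "bounded_linear (L :: real^'n \<Rightarrow> 'b::real_normed_vector)"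
  shows "L v = (\<Sum>i\<in>UNIV. v $ i *\<^sub>R L (axis i 1))"
proof -
  interpret bounded_linear L by fact
  have "L v = L (\<Sum>i\<in>UNIV. v $ i *\<^sub>R axis i 1)"
    using vec_axis_expansion[of v] by simp
  then show ?thesis by (simp add: sum scaleR)
qed

text \<open>The Hessian form along the fibre, written with derivatives on the total space in the
  vertical directions \<open>(0, axis i 1)\<close>. In this form it is visibly continuous jointly in
  the base point and the vector.\<close>

definition fibre_hessian ::
    "('p::euclidean_space \<times> (real^'n) \<Rightarrow> real) \<Rightarrow> 'p \<times> (real^'n) \<Rightarrow> real^'n \<Rightarrow> real" where
  "fibre_hessian \<theta> z v = (\<Sum>i\<in>UNIV. \<Sum>j\<in>UNIV. v $ i * v $ j *
     frechet_derivative (\<lambda>x. frechet_derivative \<theta> (at x) (0, axis j 1)) (at z) (0, axis i 1))"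

text \<open>Compactness of the unit sphere turns pointwise positivity at \<open>z0\<close> into one
  lower bound valid for all nearby \<open>z\<close>.\<close>

lemma positive_on_sphere_neighbourhood:
  fixes q :: "'z::euclidean_space \<Rightarrow> 'v::euclidean_space \<Rightarrow> real"
  assumes "open S" "z0 \<in> S" "continuous_on (S \<times> UNIV) (\<lambda>(z, v). q z v)"
    and pos: "\<And>v. v \<noteq> 0 \<Longrightarrow> q z0 v > 0"
  obtains r m where "r > 0" "m > 0" "cball z0 r \<subseteq> S"
    "\<And>z v. z \<in> cball z0 r \<Longrightarrow> norm v = 1 \<Longrightarrow> q z v \<ge> m"
proof -
  obtain s where s: "s > 0" "cball z0 s \<subseteq> S"
    using assms(1,2) open_contains_cball by blast
  let ?K = "cball z0 s \<times> sphere (0::'v) 1"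
  have contK: "continuous_on ?K (\<lambda>(z, v). q z v)"
    by (rule continuous_on_subset[OF assms(3)]) (use s in auto)
  have "uniformly_continuous_on ?K (\<lambda>(z, v). q z v)"
    by (rule compact_uniformly_continuous[OF contK]) (simp add: compact_Times)
  moreover have "continuous_on (sphere 0 1) (\<lambda>v. q z0 v)"
    using continuous_on_compose2[OF contK, of "sphere 0 1" "\<lambda>v. (z0, v)"] s
    by (fastforce intro: continuous_intros)
  then obtain v0 where v0: "v0 \<in> sphere (0::'v) 1" "\<And>v. v \<in> sphere 0 1 \<Longrightarrow> q z0 v0 \<le> q z0 v"
    using continuous_attains_inf[of "sphere (0::'v) 1" "\<lambda>v. q z0 v"] by auto
  \<comment> \<open>Half of the minimum at \<open>z0\<close>; the other half is left for the
    variation of \<open>q\<close> with \<open>z\<close>.\<close>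
  define m where "m = q z0 v0 / 2"
  have "m > 0" using pos[of v0] v0(1) by (force simp: m_def)
  ultimately obtain d where d: "d > 0" "\<And>x y. x \<in> ?K \<Longrightarrow> y \<in> ?K \<Longrightarrow> dist x y < d \<Longrightarrow>
      dist ((\<lambda>(z, v). q z v) x) ((\<lambda>(z, v). q z v) y) < m"
    unfolding uniformly_continuous_on_def by (metis (no_types, lifting))
  define r where "r = min s (d/2)"
  have "q z v \<ge> m" if z: "z \<in> cball z0 r" and v: "norm v = 1" for z v
  proof -
    have "dist (q z v) (q z0 v) < m"
      using d(2)[of "(z,v)" "(z0,v)"] z v s(1) d(1) by (auto simp: r_def dist_Pair_Pair dist_commute)
    moreover have "q z0 v \<ge> 2 * m" using v0(2)[of v] v by (simp add: m_def)
    ultimately show ?thesis by (auto simp: dist_real_def)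
  qed
  moreover have "r > 0" "cball z0 r \<subseteq> S" using s d by (auto simp: r_def)
  ultimately show ?thesis using that \<open>m > 0\<close> by blast
qed

lemma fibre_hessian_scaleR: "fibre_hessian \<theta> z (s *\<^sub>R v) = s\<^sup>2 * fibre_hessian \<theta> z v"
  by (simp add: fibre_hessian_def sum_distrib_left power2_eq_square mult_ac)

text \<open>Positive definiteness at one point gives a Hessian bound \<open>m0 * |v|^2\<close> on a
  ball, and integrating it along segments in a fibre gives strong convexity with a modulus common to
  all nearby fibres.\<close>

lemma fibre_midpoint_convexity:
  fixes \<theta> :: "'p::euclidean_space \<times> (real^'n) \<Rightarrow> real"
  assumes "open S" "(p0, w0) \<in> S" and smooth: "smooth_on S \<theta>"
    and pos: "\<And>v. v \<noteq> 0 \<Longrightarrow> fibre_hessian \<theta> (p0, w0) v > 0"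
  obtains r m where "r > 0" "m > 0" "cball p0 r \<times> cball w0 r \<subseteq> S"
    "\<And>p w w'. \<lbrakk>p \<in> cball p0 r; w \<in> cball w0 r; w' \<in> cball w0 r\<rbrakk> \<Longrightarrow>
      \<theta> (p, (1/2) *\<^sub>R (w + w')) \<le> (\<theta> (p, w) + \<theta> (p, w')) / 2 - m * (norm (w - w'))\<^sup>2"
proof -
  let ?D = "\<lambda>z. frechet_derivative \<theta> (at z)"
  let ?H = "\<lambda>i j z. frechet_derivative (\<lambda>x. ?D x (0, axis j 1)) (at z) (0, axis i 1)"
  have smD: "smooth_on S (\<lambda>x. ?D x (0, axis j 1))" for j
    by (rule smooth_on_frechet_derivative[OF smooth])
  have contH: "continuous_on S (?H i j)" for i j
    by (intro smooth_on_imp_continuous_on smooth_on_frechet_derivative smooth)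
  have "continuous_on (S \<times> UNIV) (\<lambda>(z, v). fibre_hessian \<theta> z v)"
    unfolding fibre_hessian_def case_prod_beta
    by (intro continuous_intros continuous_on_compose2[OF contH, of _ fst]) auto
  then obtain r0 m0 where r0: "r0 > 0" "m0 > 0" "cball (p0, w0) r0 \<subseteq> S"
    and H: "\<And>z v. z \<in> cball (p0, w0) r0 \<Longrightarrow> norm v = 1 \<Longrightarrow> fibre_hessian \<theta> z v \<ge> m0"
    using positive_on_sphere_neighbourhood[of S "(p0, w0)" "fibre_hessian \<theta>"] assms(1,2) pos
    by metis
  have H': "fibre_hessian \<theta> z v \<ge> m0 * (norm v)\<^sup>2" if "z \<in> cball (p0, w0) r0" for z v
  proof (cases "v = 0")
    case True
    then show ?thesis by (simp add: fibre_hessian_def)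
  next
    case False
    then have "m0 \<le> fibre_hessian \<theta> z ((1 / norm v) *\<^sub>R v)"
      by (intro H that) simp
    then show ?thesis using False unfolding fibre_hessian_scaleR
      by (simp add: field_simps)
  qed
  \<comment> \<open>Two distances of at most \<open>r0 / 2\<close> add up to at most
    \<open>r0\<close>, so the product of the balls fits into the ball of the product space.\<close>
  define r where "r = r0 / 2"
  have sub: "cball p0 r \<times> cball w0 r \<subseteq> cball (p0, w0) r0"
  proof
    fix z assume "z \<in> cball p0 r \<times> cball w0 r"
    then have "dist p0 (fst z) + dist w0 (snd z) \<le> r0" by (auto simp: r_def)
    moreover have "dist (p0, w0) z \<le> dist p0 (fst z) + dist w0 (snd z)"
      using sqrt_sum_squares_le_sum[of "dist p0 (fst z)" "dist w0 (snd z)"]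
      by (cases z) (simp add: dist_Pair_Pair)
    ultimately show "z \<in> cball (p0, w0) r0" by simp
  qed
  have "\<theta> (p, (1/2) *\<^sub>R (w + w')) \<le> (\<theta> (p, w) + \<theta> (p, w')) / 2 - m0 / 8 * (norm (w - w'))\<^sup>2"
    if p: "p \<in> cball p0 r" and w: "w \<in> cball w0 r" "w' \<in> cball w0 r" for p w w'
  proof -
    define v where "v = w' - w"
    let ?g = "\<lambda>t. (p, w + t *\<^sub>R v)"
    have inb: "?g t \<in> cball (p0, w0) r0" if "t \<in> {0..1}" for t
    proof -
      have "(1 - t) *\<^sub>R w + t *\<^sub>R w' \<in> cball w0 r"
        using convexD_alt[OF convex_cball w] that by auto
      moreover have "(1 - t) *\<^sub>R w + t *\<^sub>R w' = w + t *\<^sub>R v" by (simp add: v_def algebra_simps)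
      ultimately have "?g t \<in> cball p0 r \<times> cball w0 r" using p by simp
      then show ?thesis by (rule subsetD[OF sub])
    qed
    have inS: "?g t \<in> S" if "t \<in> {0..1}" for t using inb[OF that] r0 by auto
    have line: "(?g has_derivative (\<lambda>s. s *\<^sub>R (0, v))) (at t)" for t
      by (auto intro!: derivative_eq_intros)
    have along: "((\<lambda>t. \<phi> (?g t)) has_real_derivative
        (\<Sum>i\<in>UNIV. v $ i * frechet_derivative \<phi> (at (?g t)) (0, axis i 1))) (at t)"
      if "smooth_on S \<phi>" "t \<in> {0..1}" for \<phi> t
    proof -
      let ?L = "frechet_derivative \<phi> (at (?g t))"
      have d: "(\<phi> has_derivative ?L) (at (?g t))"
        using that inS smooth_on_has_derivative by blast
      have bl: "bounded_linear ?L" using d has_derivative_bounded_linear by blast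
      have bl0: "bounded_linear (\<lambda>v. ?L (0, v))"
        by (rule bounded_linear_compose[OF bl]) (intro bounded_linear_Pair bounded_linear_zero bounded_linear_ident)
      have "((\<lambda>t. \<phi> (?g t)) has_derivative (\<lambda>s. ?L (s *\<^sub>R (0, v)))) (at t)"
        by (rule has_derivative_compose[OF line d])
      then have "((\<lambda>t. \<phi> (?g t)) has_real_derivative ?L (0, v)) (at t)"
        unfolding has_field_derivative_def linear_simps(5)[OF bl] by (simp add: mult_commute_abs)
      then show ?thesis using bounded_linear_axis_sum[OF bl0, of v] by simp
    qed
    have d1: "((\<lambda>t. \<theta> (?g t)) has_real_derivative (\<Sum>j\<in>UNIV. v $ j * ?D (?g t) (0, axis j 1))) (at t)"
      if "t \<in> {0..1}" for t by (rule along[OF smooth that])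
    have d2: "((\<lambda>t. \<Sum>j\<in>UNIV. v $ j * ?D (?g t) (0, axis j 1)) has_real_derivative
        fibre_hessian \<theta> (?g t) v) (at t)" if "t \<in> {0..1}" for t
    proof -
      have "((\<lambda>t. \<Sum>j\<in>UNIV. v $ j * ?D (?g t) (0, axis j 1)) has_real_derivative
        (\<Sum>j\<in>UNIV. v $ j * (\<Sum>i\<in>UNIV. v $ i * ?H i j (?g t)))) (at t)"
        by (intro DERIV_sum DERIV_cmult along[OF smD that])
      moreover have "(\<Sum>j\<in>UNIV. v $ j * (\<Sum>i\<in>UNIV. v $ i * ?H i j (?g t))) = fibre_hessian \<theta> (?g t) v"
        unfolding fibre_hessian_def by (subst sum.swap) (simp add: sum_distrib_left mult_ac)
      ultimately show ?thesis by simp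
    qed
    let ?n = "(norm v)\<^sup>2"
    \<comment> \<open>The subtracted parabola uses up exactly the Hessian bound. It equals
      \<open>m0 * ?n / 8\<close> at \<open>t = 1/2\<close>, while its endpoint values average to
      \<open>m0 * ?n / 4\<close>; the difference is the constant \<open>m0 / 8\<close>.\<close>
    let ?k = "\<lambda>t. \<theta> (?g t) - m0 * ?n * t\<^sup>2 / 2"
    have "convex_on {0..1} ?k"
    proof (rule f''_ge0_imp_convex)
      show "(?k has_real_derivative (\<Sum>j\<in>UNIV. v $ j * ?D (?g t) (0, axis j 1)) - m0 * ?n * t) (at t)"
        if "t \<in> {0..1}" for t
        by (auto intro!: derivative_eq_intros d1[OF that])
      show "((\<lambda>t. (\<Sum>j\<in>UNIV. v $ j * ?D (?g t) (0, axis j 1)) - m0 * ?n * t) has_real_derivative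
         fibre_hessian \<theta> (?g t) v - m0 * ?n) (at t)" if "t \<in> {0..1}" for t
        by (intro DERIV_diff d2[OF that] DERIV_cmult_Id)
      show "0 \<le> fibre_hessian \<theta> (?g t) v - m0 * ?n" if "t \<in> {0..1}" for t
        using H'[OF inb[OF that], of v] by simp
    qed simp
    then have "?k ((1 - 1/2) *\<^sub>R 0 + (1/2) *\<^sub>R 1) \<le> (1 - 1/2) * ?k 0 + (1/2) * ?k 1"
      by (rule convex_onD) auto
    moreover have "w + (1/2) *\<^sub>R v = (1/2) *\<^sub>R (w + w')"
    proof -
      have "w + (1/2) *\<^sub>R v = (1/2) *\<^sub>R (w + w) + (1/2) *\<^sub>R v" by simp
      also have "\<dots> = (1/2) *\<^sub>R (w + w')"
        unfolding scaleR_add_right[symmetric] by (simp add: v_def)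
      finally show ?thesis .
    qed
    moreover have "norm (w - w') = norm v" by (simp add: v_def norm_minus_commute)
    moreover have "w + v = w'" by (simp add: v_def)
    ultimately show ?thesis by (simp add: power2_eq_square field_simps)
  qed
  moreover have "r > 0" "cball p0 r \<times> cball w0 r \<subseteq> S" "m0 / 8 > 0" using r0 sub by (auto simp: r_def)
  ultimately show ?thesis using that by blast
qed

text \<open>The midpoint sinks below the level 1 of \<open>M\<close>, and the homogeneous form
  \<open>opt\<close> of optimality converts this depth into a loss of the value of \<open>a\<close>.
  The midpoint carries half the loss of \<open>w\<close>, hence the factor 2. No derivative of
  \<open>M\<close> occurs, so corners of the maximum do no harm.\<close>

lemma support_growth:
  fixes M :: "'v::real_inner \<Rightarrow> real"
  assumes mid: "M ((1/2) *\<^sub>R (w1 + w)) \<le> 1 - \<mu> * (norm (w1 - w))\<^sup>2"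
    and opt: "\<And>v. a \<bullet> v \<le> M v * (a \<bullet> w1)" and nn: "a \<bullet> w1 \<ge> 0"
  shows "a \<bullet> w1 - a \<bullet> w \<ge> 2 * \<mu> * (a \<bullet> w1) * (norm (w1 - w))\<^sup>2"
proof -
  have "(a \<bullet> w1 + a \<bullet> w) / 2 = a \<bullet> ((1/2) *\<^sub>R (w1 + w))"
    by (simp add: inner_add_right)
  also have "\<dots> \<le> M ((1/2) *\<^sub>R (w1 + w)) * (a \<bullet> w1)" by (rule opt)
  also have "\<dots> \<le> (1 - \<mu> * (norm (w1 - w))\<^sup>2) * (a \<bullet> w1)"
    using mid nn by (rule mult_right_mono)
  finally have "(a \<bullet> w1 + a \<bullet> w) / 2 \<le> a \<bullet> w1 - \<mu> * (a \<bullet> w1) * (norm (w1 - w))\<^sup>2"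
    by (simp add: algebra_simps)
  then show ?thesis by simp
qed

section \<open>Maximizers of linear functionals\<close>

text \<open>Uniqueness of the maximizer at \<open>(p0, a0)\<close> is stable by compactness. The
  last clause places every maximizer near \<open>w0\<close>, not just the one found; uniqueness at
  \<open>(p, a)\<close> can then be decided by local convexity.\<close>

lemma support_maximizer_near:
  fixes M :: "'p::euclidean_space \<times> 'v::euclidean_space \<Rightarrow> real"
  assumes "open P" "p0 \<in> P" and cont: "continuous_on (P \<times> UNIV) M"
    and pos: "\<And>p w. p \<in> P \<Longrightarrow> w \<noteq> 0 \<Longrightarrow> M (p, w) > 0"
    and hom: "\<And>p w t. p \<in> P \<Longrightarrow> t > 0 \<Longrightarrow> M (p, t *\<^sub>R w) = t * M (p, w)"
    and w0: "M (p0, w0) = 1" "a0 \<bullet> w0 > 0"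
    and opt: "\<And>w. M (p0, w) = 1 \<Longrightarrow> w \<noteq> w0 \<Longrightarrow> a0 \<bullet> w < a0 \<bullet> w0"
    and "r > 0"
  obtains \<rho> where "\<rho> > 0" "ball p0 \<rho> \<subseteq> P"
    "\<And>p a. \<lbrakk>p \<in> ball p0 \<rho>; a \<in> ball a0 \<rho>\<rbrakk> \<Longrightarrow> \<exists>w\<in>ball w0 r. M (p, w) = 1 \<and>
       a \<bullet> w > (a0 \<bullet> w0) / 2 \<and> (\<forall>v. a \<bullet> v \<le> M (p, v) * (a \<bullet> w)) \<and>
       (\<forall>v. M (p, v) = 1 \<and> a \<bullet> v = a \<bullet> w \<longrightarrow> v \<in> ball w0 r)"
proof -
  let ?S = "sphere (0::'v) 1"
  obtain s where s: "s > 0" "cball p0 s \<subseteq> P"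
    using assms(1,2) open_contains_cball by blast
  \<comment> \<open>Homogeneity with factor 2 reads \<open>M (p, 0) = 2 * M (p, 0)\<close>.\<close>
  have M0: "M (p, 0) = 0" if "p \<in> P" for p
    using hom[OF that, of 2 0] by simp
  have w0n: "w0 \<noteq> 0" using w0 by auto
  have contS: "continuous_on (cball p0 s \<times> cball a0 1 \<times> ?S) (\<lambda>x. M (fst x, snd (snd x)))"
    by (rule continuous_on_compose2[OF cont]) (use s in \<open>auto intro!: continuous_intros\<close>)
  have contw0: "continuous_on (P \<times> UNIV) (\<lambda>x. M (fst x, w0))"
    by (rule continuous_on_compose2[OF cont]) (auto intro!: continuous_intros)
  have nz: "M (fst x, snd (snd x)) \<noteq> 0" if "x \<in> cball p0 s \<times> cball a0 1 \<times> ?S" for x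
  proof -
    have "fst x \<in> P" "snd (snd x) \<noteq> 0" using that s(2) by auto
    then show ?thesis using pos by fastforce
  qed
  \<comment> \<open>Radial projection from the Euclidean sphere to the unit sphere of
    \<open>M (p, _)\<close>: the varying unit spheres are all parametrized by one compact
    set.\<close>
  define w where "w x = (1 / M (fst x, snd (snd x))) *\<^sub>R snd (snd x)" for x :: "'p \<times> 'v \<times> 'v"
  \<comment> \<open>The value at the rescaled \<open>w0\<close>, a lower bound for the maximum that
    depends continuously on \<open>(p, a)\<close>.\<close>
  define b where "b y = (snd y \<bullet> w0) / M (fst y, w0)" for y :: "'p \<times> 'v"
  have cw: "continuous_on (cball p0 s \<times> cball a0 1 \<times> ?S) w"
    unfolding w_def by (intro continuous_intros contS) (use nz in auto)
  have cb: "continuous_on (P \<times> UNIV) b"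
    unfolding b_def using pos[OF _ w0n] by (intro continuous_intros contw0) (auto simp: less_le)
  let ?K = "cball p0 s \<times> cball a0 1 \<times> ?S"
  have Kc: "compact ?K" by (intro compact_Times) auto
  \<comment> \<open>Directions that are far from \<open>w0\<close> but at least as good as
    \<open>w0\<close>. This set is compact, so its projection to the pairs \<open>(p, a)\<close> is
    closed; uniqueness says that the projection misses \<open>(p0, a0)\<close>, hence also a
    neighbourhood.\<close>
  define Bad where "Bad = {x\<in>?K. r \<le> norm (w x - w0)} \<inter> {x\<in>?K. b (fst x, fst (snd x)) \<le> fst (snd x) \<bullet> w x}"
  have cb': "continuous_on ?K (\<lambda>x. b (fst x, fst (snd x)))"
    by (rule continuous_on_compose2[OF cb]) (use s in \<open>auto intro!: continuous_intros\<close>)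
  have "closed Bad" unfolding Bad_def
    by (intro closed_Int continuous_on_closed_Collect_le continuous_intros cw cb' compact_imp_closed[OF Kc])
  moreover have "Bad = Bad \<inter> ?K" by (auto simp: Bad_def)
  ultimately have "compact Bad" using Kc by (metis closed_Int_compact)
  then have "compact ((\<lambda>x. (fst x, fst (snd x))) ` Bad)"
    by (rule compact_continuous_image[rotated]) (intro continuous_intros)
  then have opn: "open (- ((\<lambda>x. (fst x, fst (snd x))) ` Bad))"
    using compact_imp_closed by blast
  have notin: "(p0, a0) \<notin> (\<lambda>x. (fst x, fst (snd x))) ` Bad"
  proof
    assume "(p0, a0) \<in> (\<lambda>x. (fst x, fst (snd x))) ` Bad"
    then obtain v where v: "(p0, a0, v) \<in> Bad" by force
    then have "v \<in> ?S" "r \<le> norm (w (p0, a0, v) - w0)" "b (p0, a0) \<le> a0 \<bullet> w (p0, a0, v)"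
      by (auto simp: Bad_def)
    moreover have "M (p0, w (p0, a0, v)) = 1"
      using hom[OF assms(2), of "1 / M (p0, v)" v] pos[OF assms(2), of v] \<open>v \<in> ?S\<close>
      by (force simp: w_def)
    ultimately show False using opt[of "w (p0, a0, v)"] \<open>r > 0\<close> w0 by (force simp: b_def)
  qed
  have "open (b -` {(a0 \<bullet> w0) / 2<..} \<inter> P \<times> UNIV)"
    using cb continuous_on_open_vimage[OF open_Times[OF assms(1) open_UNIV], of b] open_greaterThan by blast
  then have "open (- ((\<lambda>x. (fst x, fst (snd x))) ` Bad) \<inter> (b -` {(a0 \<bullet> w0) / 2<..} \<inter> P \<times> UNIV))"
    using opn by blast
  moreover have "(p0, a0) \<in> - ((\<lambda>x. (fst x, fst (snd x))) ` Bad) \<inter> (b -` {(a0 \<bullet> w0) / 2<..} \<inter> P \<times> UNIV)"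
    using notin assms(2) w0 by (auto simp: b_def)
  ultimately obtain X Y where XY: "open X" "open Y" "p0 \<in> X" "a0 \<in> Y"
    "X \<times> Y \<subseteq> - ((\<lambda>x. (fst x, fst (snd x))) ` Bad) \<inter> (b -` {(a0 \<bullet> w0) / 2<..} \<inter> P \<times> UNIV)"
    by (rule open_prod_elim) (auto simp: mem_Times_iff)
  obtain r1 r2 where rr: "r1 > 0" "ball p0 r1 \<subseteq> X" "r2 > 0" "ball a0 r2 \<subseteq> Y"
    using XY open_contains_ball by metis
  define \<rho> where "\<rho> = Min {r1, r2, s, 1}"
  have \<rho>: "\<rho> > 0" "ball p0 \<rho> \<subseteq> X" "ball a0 \<rho> \<subseteq> Y" "ball p0 \<rho> \<subseteq> cball p0 s" "ball a0 \<rho> \<subseteq> cball a0 1"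
    using rr s by (auto simp: \<rho>_def)
  have "\<exists>u\<in>ball w0 r. M (p, u) = 1 \<and> a \<bullet> u > (a0 \<bullet> w0) / 2 \<and>
      (\<forall>v. a \<bullet> v \<le> M (p, v) * (a \<bullet> u)) \<and>
      (\<forall>v. M (p, v) = 1 \<and> a \<bullet> v = a \<bullet> u \<longrightarrow> v \<in> ball w0 r)"
    if p: "p \<in> ball p0 \<rho>" and a: "a \<in> ball a0 \<rho>" for p a
  proof -
    have pP: "p \<in> P" using p \<rho> s by blast
    have K: "(p, a, v) \<in> ?K" if "v \<in> ?S" for v using p a \<rho> that by blast
    have "continuous_on ?S (\<lambda>v. a \<bullet> w (p, a, v))"
      by (intro continuous_intros continuous_on_compose2[OF cw]) (use K in auto)
    then obtain v0 where v0: "v0 \<in> ?S" "\<And>v. v \<in> ?S \<Longrightarrow> a \<bullet> w (p, a, v) \<le> a \<bullet> w (p, a, v0)"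
      using continuous_attains_sup[of ?S "\<lambda>v. a \<bullet> w (p, a, v)"] by auto
    define u where "u = w (p, a, v0)"
    have ratio: "a \<bullet> v = M (p, v) * (a \<bullet> w (p, a, (1 / norm v) *\<^sub>R v))"
      and unit: "w (p, a, (1 / norm v) *\<^sub>R v) = (1 / M (p, v)) *\<^sub>R v" if "v \<noteq> 0" for v
      using pos[OF pP that] that hom[OF pP, of "1 / norm v" v] by (auto simp: w_def)
    have Mu: "M (p, u) = 1"
      using hom[OF pP, of "1 / M (p, v0)" v0] pos[OF pP, of v0] v0(1)
      by (force simp: w_def u_def)
    have dom: "a \<bullet> v \<le> M (p, v) * (a \<bullet> u)" for v
    proof (cases "v = 0")
      case True then show ?thesis using M0[OF pP] by simp
    next
      case False
      have "M (p, v) * (a \<bullet> w (p, a, (1 / norm v) *\<^sub>R v)) \<le> M (p, v) * (a \<bullet> u)"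
        unfolding u_def by (intro mult_left_mono v0(2)) (use False pos[OF pP False] in auto)
      then show ?thesis using ratio[OF False] by simp
    qed
    have "b (p, a) \<le> a \<bullet> u"
      using dom[of w0] pos[OF pP w0n] by (simp add: b_def field_simps)
    have paXY: "(p, a) \<in> X \<times> Y" using p a \<rho> by auto
    then have nb: "(p, a) \<notin> (\<lambda>x. (fst x, fst (snd x))) ` Bad" and bb: "b (p, a) > (a0 \<bullet> w0) / 2"
      using XY(5) by auto
    have near: "v \<in> ball w0 r" if "M (p, v) = 1" "a \<bullet> v = a \<bullet> u" for v
    proof (rule ccontr)
      assume "v \<notin> ball w0 r"
      have "v \<noteq> 0" using that M0[OF pP] by auto
      then have "w (p, a, (1 / norm v) *\<^sub>R v) = v" "(1 / norm v) *\<^sub>R v \<in> ?S"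
        using unit that by auto
      then have "(p, a, (1 / norm v) *\<^sub>R v) \<in> Bad"
        using K[of "(1 / norm v) *\<^sub>R v"] \<open>v \<notin> ball w0 r\<close> \<open>b (p, a) \<le> a \<bullet> u\<close> that
        by (auto simp: Bad_def dist_norm norm_minus_commute)
      then show False using nb by force
    qed
    show ?thesis using near[OF Mu] Mu dom near bb \<open>b (p, a) \<le> a \<bullet> u\<close> by (intro bexI[of _ u]) auto
  qed
  moreover have "ball p0 \<rho> \<subseteq> P" using \<rho> s by blast
  ultimately show ?thesis using that \<rho>(1) by blast
qed

section \<open>Uniform constants for finite families\<close>

lemma continuous_on_Max_image:
  fixes f :: "'i \<Rightarrow> 'a::topological_space \<Rightarrow> real"
  assumes "finite I" "I \<noteq> {}" "\<And>i. i \<in> I \<Longrightarrow> continuous_on S (f i)"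
  shows "continuous_on S (\<lambda>x. Max ((\<lambda>i. f i x) ` I))"
  using assms
proof (induction I rule: finite_ne_induct)
  case (insert i I)
  then have "continuous_on S (\<lambda>x. max (f i x) (Max ((\<lambda>i. f i x) ` I)))"
    by (intro continuous_on_max) auto
  with insert.hyps show ?case by (simp add: image_is_empty)
qed simp

text \<open>Since \<open>Q\<close> survives shrinking of both constants, the minima over the finite
  index set serve all indices at once.\<close>

lemma uniform_radius_finite:
  assumes "finite I" "\<And>i. i \<in> I \<Longrightarrow> \<exists>r>0. \<exists>m>0. Q i r m"
    and "\<And>i r m r' m'. Q i r m \<Longrightarrow> 0 < r' \<Longrightarrow> r' \<le> r \<Longrightarrow> 0 < m' \<Longrightarrow> m' \<le> m \<Longrightarrow> Q i r' m'"
  shows "\<exists>r>0. \<exists>m>0. \<forall>i\<in>I. Q i (r::real) (m::real)"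
  using assms(1,2)
proof (induction I)
  case empty
  show ?case by (auto intro: exI[of _ 1])
next
  case (insert i I)
  obtain r m where "r > 0" "m > 0" "\<forall>i\<in>I. Q i r m" using insert by auto
  moreover obtain r' m' where "r' > 0" "m' > 0" "Q i r' m'" using insert.prems[of i] by blast
  ultimately have "\<forall>j\<in>insert i I. Q j (min r r') (min m m')" "min r r' > 0" "min m m' > 0"
    using assms(3)[of _ _ _ "min r r'" "min m m'"] by auto
  then show ?case by blast
qed

text \<open>Strong convexity can only be asked of the squares: a function homogeneous of degree one
  is linear along rays, so its own Hessian degenerates there. On the unit ball the bound for the
  square still passes to the function itself.\<close>

lemma uniform_midpoint_convexity:
  fixes \<Phi> :: "'i \<Rightarrow> ('p::euclidean_space \<times> (real^'n)) \<Rightarrow> real"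
  assumes I: "finite I" "I \<noteq> {}" and "open S" "(p0, w0) \<in> S"
    and smooth: "\<And>i. i \<in> I \<Longrightarrow> smooth_on S (\<Phi> i)"
    and hess: "\<And>i v. i \<in> I \<Longrightarrow> v \<noteq> 0 \<Longrightarrow> fibre_hessian (\<lambda>z. (\<Phi> i z)\<^sup>2) (p0, w0) v > 0"
  obtains r m where "r > 0" "m > 0" "cball p0 r \<times> cball w0 r \<subseteq> S"
    "\<forall>i\<in>I. \<forall>p\<in>cball p0 r. \<forall>w\<in>cball w0 r. \<forall>w'\<in>cball w0 r.
      \<bar>\<Phi> i (p, w)\<bar> \<le> 1 \<longrightarrow> \<bar>\<Phi> i (p, w')\<bar> \<le> 1 \<longrightarrow>
      \<Phi> i (p, (1/2) *\<^sub>R (w + w')) \<le> 1 - m * (norm (w - w'))\<^sup>2"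
proof -
  define Q where "Q i r m \<longleftrightarrow> cball p0 r \<times> cball w0 r \<subseteq> S \<and>
    (\<forall>p\<in>cball p0 r. \<forall>w\<in>cball w0 r. \<forall>w'\<in>cball w0 r. (\<Phi> i (p, (1/2) *\<^sub>R (w + w')))\<^sup>2
       \<le> ((\<Phi> i (p, w))\<^sup>2 + (\<Phi> i (p, w'))\<^sup>2) / 2 - m * (norm (w - w'))\<^sup>2)" for i r m
  have "\<exists>r>0. \<exists>m>0. \<forall>i\<in>I. Q i r m"
  proof (rule uniform_radius_finite[OF I(1)])
    fix i assume i: "i \<in> I"
    have "smooth_on S (\<lambda>z. (\<Phi> i z)\<^sup>2)"
      unfolding power2_eq_square by (intro smooth_on_mult smooth i assms(3))
    then obtain r m where "r > 0" "m > 0" "Q i r m"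
      using fibre_midpoint_convexity[OF assms(3,4) _ hess[OF i]] unfolding Q_def by metis
    then show "\<exists>r>0. \<exists>m>0. Q i r m" by blast
  next
    fix i r m r' m' :: real
    fix i assume Q: "Q i r m" and le: "r' \<le> r" "m' \<le> m"
    have sub: "cball p0 r' \<subseteq> cball p0 r" "cball w0 r' \<subseteq> cball w0 r" using le by auto
    show "Q i r' m'" unfolding Q_def
    proof (intro conjI ballI)
      show "cball p0 r' \<times> cball w0 r' \<subseteq> S" using Q sub unfolding Q_def by blast
      fix p w w' assume "p \<in> cball p0 r'" "w \<in> cball w0 r'" "w' \<in> cball w0 r'"
      then have "(\<Phi> i (p, (1/2) *\<^sub>R (w + w')))\<^sup>2
          \<le> ((\<Phi> i (p, w))\<^sup>2 + (\<Phi> i (p, w'))\<^sup>2) / 2 - m * (norm (w - w'))\<^sup>2"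
        using Q sub unfolding Q_def by blast
      moreover have "m' * (norm (w - w'))\<^sup>2 \<le> m * (norm (w - w'))\<^sup>2"
        using le by (simp add: mult_right_mono)
      ultimately show "(\<Phi> i (p, (1/2) *\<^sub>R (w + w')))\<^sup>2
          \<le> ((\<Phi> i (p, w))\<^sup>2 + (\<Phi> i (p, w'))\<^sup>2) / 2 - m' * (norm (w - w'))\<^sup>2"
        by linarith
    qed
  qed
  then obtain r m where rm: "r > 0" "m > 0" "\<And>i. i \<in> I \<Longrightarrow> Q i r m" by blast
  have "\<Phi> i (p, (1/2) *\<^sub>R (w + w')) \<le> 1 - m / 2 * (norm (w - w'))\<^sup>2"
    if *: "p \<in> cball p0 r" "w \<in> cball w0 r" "w' \<in> cball w0 r" "i \<in> I"
      "\<bar>\<Phi> i (p, w)\<bar> \<le> 1" "\<bar>\<Phi> i (p, w')\<bar> \<le> 1" for i p w w'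
  proof -
    let ?x = "\<Phi> i (p, (1/2) *\<^sub>R (w + w'))"
    have "?x\<^sup>2 \<le> ((\<Phi> i (p, w))\<^sup>2 + (\<Phi> i (p, w'))\<^sup>2) / 2 - m * (norm (w - w'))\<^sup>2"
      using rm(3)[OF *(4)] * unfolding Q_def by blast
    moreover have "(\<Phi> i (p, w))\<^sup>2 \<le> 1" "(\<Phi> i (p, w'))\<^sup>2 \<le> 1"
      using *(5,6) abs_square_le_1 by auto
    \<comment> \<open>The tangent line of the square at 1 removes the square at the cost of half the
      modulus.\<close>
    moreover have "2 * ?x \<le> 1 + ?x\<^sup>2"
      using zero_le_power2[of "1 - ?x"] by (simp add: power2_diff)
    ultimately have "?x \<le> 1 - (m * (norm (w - w'))\<^sup>2) / 2" by argo
    then show ?thesis by simp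
  qed
  moreover have "cball p0 r \<times> cball w0 r \<subseteq> S" using rm(3) I(2) unfolding Q_def by blast
  ultimately show ?thesis using that[of r "m / 2"] rm(1,2) by auto
qed

lemma open_contains_cball_times:
  assumes "open S" "(x, y) \<in> S"
  obtains r where "r > 0" "cball x r \<times> cball y r \<subseteq> S"
proof -
  obtain X Y where XY: "open X" "open Y" "x \<in> X" "y \<in> Y" "X \<times> Y \<subseteq> S"
    using assms by (auto elim: open_prod_elim)
  obtain r1 r2 where "r1 > 0" "cball x r1 \<subseteq> X" "r2 > 0" "cball y r2 \<subseteq> Y"
    using XY open_contains_cball by metis
  moreover have "cball x (min r1 r2) \<subseteq> cball x r1" "cball y (min r1 r2) \<subseteq> cball y r2" by auto
  ultimately have "cball x (min r1 r2) \<times> cball y (min r1 r2) \<subseteq> S" "min r1 r2 > 0"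
    using XY(5) by (blast, simp)
  then show ?thesis using that by blast
qed

text \<open>A product rule for differences in which every term keeps the factor \<open>n\<close>, to
  be taken as the distance of two controls.\<close>

lemma bilinear_mixed_difference:
  fixes a a' x x' y y' :: "'v::real_inner"
  assumes "norm (x - x') \<le> K * n" "norm ((x - x') - (y - y')) \<le> L * d * n" "norm a' \<le> B" "0 \<le> n"
    "0 \<le> L" "0 \<le> d"
  shows "a \<bullet> (x - x') - a' \<bullet> (y - y') \<le> (K * norm (a - a') + B * L * d) * n"
proof -
  have "a \<bullet> (x - x') - a' \<bullet> (y - y') = (a - a') \<bullet> (x - x') + a' \<bullet> ((x - x') - (y - y'))"
    by (simp add: inner_diff_left inner_diff_right)
  also have "\<dots> \<le> norm (a - a') * norm (x - x') + norm a' * norm ((x - x') - (y - y'))"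
    by (intro add_mono norm_cauchy_schwarz)
  also have "\<dots> \<le> norm (a - a') * (K * n) + B * (L * d * n)"
    using assms order_trans[OF norm_ge_zero assms(3)]
    by (intro add_mono mult_mono mult_nonneg_nonneg) auto
  finally show ?thesis by (simp add: algebra_simps)
qed

text \<open>The Euclidean core of the argument. \<open>\<Phi> i\<close> plays the role of a Finsler
  structure in a chart, \<open>\<Psi>\<close> of the vertical part of the coordinates,
  \<open>f\<close> of the control fields. The functions \<open>l i\<close> take no base point: they
  express that the constraints depend on the control alone. \<open>R\<close> lets the caller keep
  controls inside a prescribed cube.\<close>

theorem maximizing_control_lipschitz:
  fixes \<Phi> :: "'i \<Rightarrow> 'p::euclidean_space \<times> (real^'n) \<Rightarrow> real"
    and \<Psi> :: "'p \<times> (real^'n) \<Rightarrow> 'u::euclidean_space" and f :: "'p \<times> 'u \<Rightarrow> real^'n"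
    and l :: "'i \<Rightarrow> 'u \<Rightarrow> real" and I :: "'i set" and p0 w0 a0 P D E R
  defines "M \<equiv> \<lambda>z. Max ((\<lambda>i. \<Phi> i z) ` I)" and "u0 \<equiv> \<Psi> (p0, w0)"
  assumes I: "finite I" "I \<noteq> {}"
    and P: "open P" "p0 \<in> P"
    and cont: "\<And>i. i \<in> I \<Longrightarrow> continuous_on (P \<times> UNIV) (\<Phi> i)"
    and smooth: "\<And>i. i \<in> I \<Longrightarrow> smooth_on (P \<times> (- {0})) (\<Phi> i)"
    and pos: "\<And>i p w. i \<in> I \<Longrightarrow> p \<in> P \<Longrightarrow> w \<noteq> 0 \<Longrightarrow> \<Phi> i (p, w) > 0"
    and hom: "\<And>i p w t. i \<in> I \<Longrightarrow> p \<in> P \<Longrightarrow> t > 0 \<Longrightarrow> \<Phi> i (p, t *\<^sub>R w) = t * \<Phi> i (p, w)"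
    and hess: "\<And>i v. i \<in> I \<Longrightarrow> v \<noteq> 0 \<Longrightarrow> fibre_hessian (\<lambda>z. (\<Phi> i z)\<^sup>2) (p0, w0) v > 0"
    and w0: "w0 \<noteq> 0" "M (p0, w0) = 1" "a0 \<bullet> w0 > 0"
    and opt: "\<And>w. M (p0, w) = 1 \<Longrightarrow> w \<noteq> w0 \<Longrightarrow> a0 \<bullet> w < a0 \<bullet> w0"
    and D: "open D" "(p0, w0) \<in> D" "smooth_on D \<Psi>"
    and E: "open E" "smooth_on E f"
    and f\<Psi>: "\<And>p w. (p, w) \<in> D \<Longrightarrow> (p, \<Psi> (p, w)) \<in> E" "\<And>p w. (p, w) \<in> D \<Longrightarrow> f (p, \<Psi> (p, w)) = w"
    and \<Psi>f: "\<And>p u. (p, u) \<in> E \<Longrightarrow> (p, f (p, u)) \<in> D" "\<And>p u. (p, u) \<in> E \<Longrightarrow> \<Psi> (p, f (p, u)) = u"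
    and l: "\<And>i p w. i \<in> I \<Longrightarrow> (p, w) \<in> D \<Longrightarrow> \<Phi> i (p, w) = l i (\<Psi> (p, w))"
    and "R > 0"
  obtains \<rho> s L \<mu> where "0 < \<rho>" "\<rho> \<le> R" "s \<le> R" "ball p0 \<rho> \<subseteq> P" "cball p0 \<rho> \<times> cball u0 s \<subseteq> E" "L > 0"
    "\<And>p a. \<lbrakk>p \<in> ball p0 \<rho>; a \<in> ball a0 \<rho>\<rbrakk> \<Longrightarrow> \<mu> p a \<in> ball u0 s \<and> M (p, f (p, \<mu> p a)) = 1 \<and>
      (\<forall>v. M (p, v) = 1 \<and> v \<noteq> f (p, \<mu> p a) \<longrightarrow> a \<bullet> v < a \<bullet> f (p, \<mu> p a))"
    "\<And>p a p' a'. \<lbrakk>p \<in> ball p0 \<rho>; a \<in> ball a0 \<rho>; p' \<in> ball p0 \<rho>; a' \<in> ball a0 \<rho>\<rbrakk> \<Longrightarrow>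
      norm (\<mu> p a - \<mu> p' a') \<le> L * (norm (p - p') + norm (a - a'))"
proof -
  have Mle: "M z \<le> b \<longleftrightarrow> (\<forall>i\<in>I. \<Phi> i z \<le> b)" for z b
    unfolding M_def using I by auto
  have Mcont: "continuous_on (P \<times> UNIV) M"
    unfolding M_def by (rule continuous_on_Max_image[OF I cont])
  have Mpos: "M (p, w) > 0" if "p \<in> P" "w \<noteq> 0" for p w
    using Mle[of "(p, w)" "M (p, w)"] I(2) pos[OF _ that] by fastforce
  have Mhom: "M (p, t *\<^sub>R w) = t * M (p, w)" if "p \<in> P" "t > 0" for p w t
  proof -
    \<comment> \<open>One inequality is enough: used for \<open>1/t\<close> and
      \<open>t *\<^sub>R w\<close> it becomes the reverse one.\<close>
    have "M (p, t *\<^sub>R w) \<le> t * M (p, w)" if "t > 0" for t w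
      unfolding Mle using Mle[of "(p, w)" "M (p, w)"] hom[OF _ \<open>p \<in> P\<close> that] that by auto
    from this[OF \<open>t > 0\<close>] this[of "1/t" "t *\<^sub>R w"] show ?thesis
      using \<open>t > 0\<close> by (intro antisym) (simp_all add: field_simps)
  qed
  have slit: "open (P \<times> (- {0::real^'n}))" "(p0, w0) \<in> P \<times> - {0}"
    using P w0 by (auto intro: open_Times)
  obtain r1 m where r1: "r1 > 0" "m > 0" "cball p0 r1 \<times> cball w0 r1 \<subseteq> P \<times> - {0}"
    and mid: "\<forall>i\<in>I. \<forall>p\<in>cball p0 r1. \<forall>w\<in>cball w0 r1. \<forall>w'\<in>cball w0 r1.
      \<bar>\<Phi> i (p, w)\<bar> \<le> 1 \<longrightarrow> \<bar>\<Phi> i (p, w')\<bar> \<le> 1 \<longrightarrow>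
      \<Phi> i (p, (1/2) *\<^sub>R (w + w')) \<le> 1 - m * (norm (w - w'))\<^sup>2"
    by (rule uniform_midpoint_convexity[OF I slit smooth hess])
  obtain r2 where r2: "r2 > 0" "cball p0 r2 \<times> cball w0 r2 \<subseteq> D"
    by (rule open_contains_cball_times[OF D(1,2)])
  define r where "r = min r1 r2"
  have r: "r > 0" "cball p0 r \<times> cball w0 r \<subseteq> D" "cball p0 r \<times> cball w0 r \<subseteq> P \<times> - {0}"
    "cball p0 r \<subseteq> cball p0 r1" "cball w0 r \<subseteq> cball w0 r1"
  proof -
    show "r > 0" using r1 r2 by (simp add: r_def)
    show *: "cball p0 r \<subseteq> cball p0 r1" "cball w0 r \<subseteq> cball w0 r1" by (auto simp: r_def)
    show "cball p0 r \<times> cball w0 r \<subseteq> P \<times> - {0}" using * r1(3) by blast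
    have "cball p0 r \<subseteq> cball p0 r2" "cball w0 r \<subseteq> cball w0 r2" by (auto simp: r_def)
    then show "cball p0 r \<times> cball w0 r \<subseteq> D" using r2(2) by blast
  qed
  obtain K where K: "K > 0" "\<And>x y. x \<in> cball p0 r \<times> cball w0 r \<Longrightarrow> y \<in> cball p0 r \<times> cball w0 r \<Longrightarrow>
      norm (\<Psi> x - \<Psi> y) \<le> K * norm (x - y)"
    by (rule smooth_on_lipschitz[OF D(3) r(2)]) (auto simp: compact_Times convex_Times)
  have u0E: "(p0, u0) \<in> E" and fu0: "f (p0, u0) = w0"
    using f\<Psi> D(2) by (auto simp: u0_def)
  have "open (f -` ball w0 r \<inter> E)"
    using smooth_on_imp_continuous_on[OF E(2)] continuous_on_open_vimage[OF E(1)] open_ball by blast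
  then obtain s1 where s1: "s1 > 0" "cball p0 s1 \<times> cball u0 s1 \<subseteq> f -` ball w0 r \<inter> E"
    by (rule open_contains_cball_times) (use u0E fu0 r(1) in auto)
  \<comment> \<open>Controls within \<open>s\<close> of \<open>u0\<close> are sent by every nearby
    fibre into the ball where midpoint convexity holds. This will apply to a control transported
    from another base point.\<close>
  define s where "s = Min {s1, r, R}"
  have s: "s > 0" "s \<le> R" "s \<le> r" "cball p0 s \<times> cball u0 s \<subseteq> E"
    "\<And>p u. p \<in> cball p0 s \<Longrightarrow> u \<in> cball u0 s \<Longrightarrow> f (p, u) \<in> ball w0 r"
  proof -
    show "s > 0" "s \<le> R" "s \<le> r" using s1 r \<open>R > 0\<close> by (auto simp: s_def)
    have "cball p0 s \<subseteq> cball p0 s1" "cball u0 s \<subseteq> cball u0 s1" by (auto simp: s_def)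
    then have sub: "cball p0 s \<times> cball u0 s \<subseteq> f -` ball w0 r \<inter> E" using s1(2) by blast
    then show "cball p0 s \<times> cball u0 s \<subseteq> E" by blast
    show "f (p, u) \<in> ball w0 r" if "p \<in> cball p0 s" "u \<in> cball u0 s" for p u
      using sub that by blast
  qed
  obtain Lf where Lf: "Lf > 0" "\<And>x y. x \<in> cball p0 s \<times> cball u0 s \<Longrightarrow> y \<in> cball p0 s \<times> cball u0 s \<Longrightarrow>
      norm (f x - f y) \<le> Lf * norm (x - y)"
    by (rule smooth_on_lipschitz[OF E(2) s(4)]) (auto simp: compact_Times convex_Times)
  obtain Lm where Lm: "Lm > 0" "\<And>p p' u u'. \<lbrakk>p \<in> cball p0 s; p' \<in> cball p0 s; u \<in> cball u0 s; u' \<in> cball u0 s\<rbrakk>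
     \<Longrightarrow> norm ((f (p, u) - f (p, u')) - (f (p', u) - f (p', u'))) \<le> Lm * norm (p - p') * norm (u - u')"
    by (rule smooth_on_mixed_difference[OF E(2) s(4)]) auto
  \<comment> \<open>Conversely, \<open>r3\<close> is chosen so that vectors within \<open>r3\<close>
    of \<open>w0\<close> have controls within \<open>s\<close> of \<open>u0\<close>. Maximizers are
    confined to \<open>min r r3\<close> to satisfy both requirements.\<close>
  have "open (\<Psi> -` ball u0 s \<inter> D)"
    using smooth_on_imp_continuous_on[OF D(3)] continuous_on_open_vimage[OF D(1)] open_ball by blast
  then obtain r3 where r3: "r3 > 0" "cball p0 r3 \<times> cball w0 r3 \<subseteq> \<Psi> -` ball u0 s \<inter> D"
    by (rule open_contains_cball_times) (use D(2) s(1) in \<open>auto simp: u0_def\<close>)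
  obtain \<rho>1 where \<rho>1: "\<rho>1 > 0" "ball p0 \<rho>1 \<subseteq> P"
    and ex: "\<And>p a. \<lbrakk>p \<in> ball p0 \<rho>1; a \<in> ball a0 \<rho>1\<rbrakk> \<Longrightarrow> \<exists>w\<in>ball w0 (min r r3). M (p, w) = 1 \<and>
       a \<bullet> w > (a0 \<bullet> w0) / 2 \<and> (\<forall>v. a \<bullet> v \<le> M (p, v) * (a \<bullet> w)) \<and>
       (\<forall>v. M (p, v) = 1 \<and> a \<bullet> v = a \<bullet> w \<longrightarrow> v \<in> ball w0 (min r r3))"
  proof (rule support_maximizer_near[OF P Mcont Mpos Mhom w0(2,3) opt])
    show "0 < min r r3" using r r3 by simp
  qed auto
  define \<rho> where "\<rho> = Min {\<rho>1, s, r3, 1}"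
  have \<rho>: "\<rho> > 0" "\<rho> \<le> s" "\<rho> \<le> 1" "ball p0 \<rho> \<subseteq> ball p0 \<rho>1" "ball a0 \<rho> \<subseteq> ball a0 \<rho>1"
    "cball p0 \<rho> \<subseteq> cball p0 s" "cball p0 \<rho> \<subseteq> cball p0 r3" "cball p0 \<rho> \<subseteq> cball p0 r"
    using \<rho>1 s r3 by (auto simp: \<rho>_def)
  have in_cball: "p \<in> cball p0 s" "p \<in> cball p0 r3" "p \<in> cball p0 r" if "p \<in> ball p0 \<rho>" for p
    using that \<rho>(6,7,8) ball_subset_cball[of p0 \<rho>] by blast+
  \<comment> \<open>Half of the optimal value at \<open>(p0, a0)\<close>; it bounds all nearby
    optimal values from below and makes the growth constant uniform.\<close>
  define \<kappa> where "\<kappa> = (a0 \<bullet> w0) / 2"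
  have \<kappa>: "\<kappa> > 0" using w0 by (simp add: \<kappa>_def)
  define T where "T p a w \<longleftrightarrow> w \<in> ball w0 (min r r3) \<and> M (p, w) = 1 \<and>
       a \<bullet> w > \<kappa> \<and> (\<forall>v. a \<bullet> v \<le> M (p, v) * (a \<bullet> w)) \<and>
       (\<forall>v. M (p, v) = 1 \<and> a \<bullet> v = a \<bullet> w \<longrightarrow> v \<in> ball w0 (min r r3))" for p a w
  have Tex: "\<exists>w. T p a w" if "p \<in> ball p0 \<rho>" "a \<in> ball a0 \<rho>" for p a
    using ex[of p a] \<rho>(4,5) that unfolding T_def \<kappa>_def by blast
  \<comment> \<open>A choice among maximizers; that there is only one follows in
    \<open>opt'\<close>.\<close>
  define \<omega> where "\<omega> p a = (SOME w. T p a w)" for p a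
  have \<omega>: "\<And>p a. p \<in> ball p0 \<rho> \<Longrightarrow> a \<in> ball a0 \<rho> \<Longrightarrow>
       \<omega> p a \<in> ball w0 (min r r3) \<and> M (p, \<omega> p a) = 1 \<and>
       a \<bullet> \<omega> p a > \<kappa> \<and> (\<forall>v. a \<bullet> v \<le> M (p, v) * (a \<bullet> \<omega> p a)) \<and>
       (\<forall>v. M (p, v) = 1 \<and> a \<bullet> v = a \<bullet> \<omega> p a \<longrightarrow> v \<in> ball w0 (min r r3))"
    using someI_ex[OF Tex] unfolding \<omega>_def[symmetric] unfolding T_def .
  define \<mu> where "\<mu> p a = \<Psi> (p, \<omega> p a)" for p a
  have absle: "\<bar>\<Phi> i (p, w)\<bar> \<le> 1" if "p \<in> cball p0 r" "w \<in> cball w0 r" "M (p, w) \<le> 1" "i \<in> I" for p w i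
  proof -
    have "p \<in> P" "w \<noteq> 0" using r(3) that by blast+
    then show ?thesis using that Mle[of "(p, w)" 1] pos[of i p w] by auto
  qed
  have growth: "2 * m * \<kappa> * (norm (\<omega> p a - v))\<^sup>2 \<le> a \<bullet> \<omega> p a - a \<bullet> v"
    if pa: "p \<in> ball p0 \<rho>" "a \<in> ball a0 \<rho>" and v: "v \<in> cball w0 r" "M (p, v) \<le> 1" for p a v
  proof -
    have pr: "p \<in> cball p0 r" using in_cball(3)[OF pa(1)] .
    have wr: "\<omega> p a \<in> cball w0 r" using \<omega>[OF pa] by auto
    have "M (p, (1/2) *\<^sub>R (\<omega> p a + v)) \<le> 1 - m * (norm (\<omega> p a - v))\<^sup>2"
      unfolding Mle
      by (intro ballI mid[rule_format]) (use subsetD[OF r(4) pr] subsetD[OF r(5) wr] subsetD[OF r(5) v(1)]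
          absle[OF pr wr] absle[OF pr v] \<omega>[OF pa] in auto)
    then have "2 * m * (a \<bullet> \<omega> p a) * (norm (\<omega> p a - v))\<^sup>2 \<le> a \<bullet> \<omega> p a - a \<bullet> v"
      by (rule support_growth[of "\<lambda>v. M (p, v)"]) (use \<omega>[OF pa] \<kappa> in auto)
    moreover have "2 * m * \<kappa> * (norm (\<omega> p a - v))\<^sup>2 \<le> 2 * m * (a \<bullet> \<omega> p a) * (norm (\<omega> p a - v))\<^sup>2"
      by (intro mult_right_mono mult_left_mono) (use \<omega>[OF pa] r1 in auto)
    ultimately show ?thesis by linarith
  qed
  have \<mu>: "\<mu> p a \<in> ball u0 s" "f (p, \<mu> p a) = \<omega> p a" if pa: "p \<in> ball p0 \<rho>" "a \<in> ball a0 \<rho>" for p a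
  proof -
    have "(p, \<omega> p a) \<in> cball p0 r3 \<times> cball w0 r3"
      using \<omega>[OF pa] in_cball(2)[OF pa(1)] by auto
    then have "(p, \<omega> p a) \<in> \<Psi> -` ball u0 s \<inter> D" using r3(2) by blast
    then show "\<mu> p a \<in> ball u0 s" "f (p, \<mu> p a) = \<omega> p a"
      using f\<Psi>(2) by (auto simp: \<mu>_def)
  qed
  \<comment> \<open>A competitor with the same value would also lie near \<open>w0\<close>, and
    there the quadratic growth forces it to coincide with \<open>\<omega> p a\<close>.\<close>
  have opt': "a \<bullet> v < a \<bullet> \<omega> p a"
    if pa: "p \<in> ball p0 \<rho>" "a \<in> ball a0 \<rho>" and v: "M (p, v) = 1" "v \<noteq> \<omega> p a" for p a v
  proof (rule ccontr)
    assume "\<not> a \<bullet> v < a \<bullet> \<omega> p a"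
    moreover have "a \<bullet> v \<le> M (p, v) * (a \<bullet> \<omega> p a)" using \<omega>[OF pa] by blast
    ultimately have eq: "a \<bullet> v = a \<bullet> \<omega> p a" using v(1) by simp
    then have "v \<in> ball w0 (min r r3)" using \<omega>[OF pa] v(1) by blast
    then have "2 * m * \<kappa> * (norm (\<omega> p a - v))\<^sup>2 \<le> 0"
      using growth[OF pa, of v] v(1) eq by auto
    moreover have "2 * m * \<kappa> * (norm (\<omega> p a - v))\<^sup>2 > 0"
      using r1 \<kappa> v(2) by (intro mult_pos_pos) auto
    ultimately show False by linarith
  qed
  define B where "B = norm a0 + 1"
  have B: "norm a \<le> B" if "a \<in> ball a0 \<rho>" for a
    using that \<rho>(3) norm_triangle_ineq2[of a a0] by (auto simp: B_def dist_norm norm_minus_commute)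
  \<comment> \<open>\<open>\<Psi>\<close> is \<open>K\<close>-Lipschitz, so a squared distance of
    vectors dominates the squared distance of controls divided by \<open>K\<^sup>2\<close>.\<close>
  define b where "b = 2 * m * \<kappa> / K\<^sup>2"
  have b: "b > 0" using r1 \<kappa> K by (simp add: b_def)
  have growth\<mu>: "b * (norm (\<mu> p a - u))\<^sup>2 \<le> a \<bullet> f (p, \<mu> p a) - a \<bullet> f (p, u)"
    if pa: "p \<in> ball p0 \<rho>" "a \<in> ball a0 \<rho>" and q: "p' \<in> ball p0 \<rho>" "a' \<in> ball a0 \<rho>" and "u = \<mu> p' a'"
    for p a p' a' u
  proof -
    have ps: "p \<in> cball p0 s" "p' \<in> cball p0 s" using in_cball(1) pa(1) q(1) by blast+
    have us: "u \<in> cball u0 s" using \<mu>(1)[OF q] \<open>u = _\<close> by auto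
    have fb: "f (p, u) \<in> cball w0 r" using s(5)[OF ps(1) us] by auto
    have inE: "(p, u) \<in> E" "(p', u) \<in> E" using s(4) ps us by blast+
    \<comment> \<open>Feasibility is a condition on \<open>u\<close> alone, so it carries over from \<open>p'\<close> to \<open>p\<close>.\<close>
    have "\<Phi> i (p, f (p, u)) \<le> 1" if i: "i \<in> I" for i
    proof -
      have "\<Phi> i (p, f (p, u)) = \<Phi> i (p', f (p', u))"
        using l[OF i \<Psi>f(1)[OF inE(1)]] l[OF i \<Psi>f(1)[OF inE(2)]] \<Psi>f(2) inE by simp
      then show ?thesis using Mle[of "(p', \<omega> p' a')" 1] \<omega>[OF q] \<mu>(2)[OF q] i \<open>u = _\<close> by auto
    qed
    then have g: "2 * m * \<kappa> * (norm (\<omega> p a - f (p, u)))\<^sup>2 \<le> a \<bullet> \<omega> p a - a \<bullet> f (p, u)"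
      by (intro growth[OF pa fb]) (simp add: Mle)
    have "norm (\<Psi> (p, \<omega> p a) - \<Psi> (p, f (p, u))) \<le> K * norm ((p, \<omega> p a) - (p, f (p, u)))"
      by (rule K(2)) (use in_cball(3)[OF pa(1)] \<omega>[OF pa] fb in auto)
    then have "norm (\<mu> p a - u) \<le> K * norm (\<omega> p a - f (p, u))"
      using \<Psi>f(2)[OF inE(1)] by (simp add: \<mu>_def norm_Pair)
    then have "(norm (\<mu> p a - u))\<^sup>2 \<le> K\<^sup>2 * (norm (\<omega> p a - f (p, u)))\<^sup>2"
      unfolding power_mult_distrib[symmetric] by (intro power_mono) auto
    then have "b * (norm (\<mu> p a - u))\<^sup>2 \<le> b * (K\<^sup>2 * (norm (\<omega> p a - f (p, u)))\<^sup>2)"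
      by (intro mult_left_mono) (use b in auto)
    also have "\<dots> = 2 * m * \<kappa> * (norm (\<omega> p a - f (p, u)))\<^sup>2" using K(1) by (simp add: b_def)
    finally show ?thesis using g \<mu>(2)[OF pa] by simp
  qed
  define c where "c = 2 * b"
  have c: "c > 0" using b by (simp add: c_def)
  \<comment> \<open>\<open>Lf\<close> pays for the change of \<open>a\<close> and
    \<open>B * Lm\<close> for the change of \<open>p\<close>; the divisor \<open>c = 2 * b\<close>
    comes from adding the growth inequalities at both points.\<close>
  define L where "L = (Lf + B * Lm) / c"
  have Bp: "B > 0" using norm_ge_zero[of a0] unfolding B_def by linarith
  have Lpos: "L > 0" using Lf Lm c Bp by (simp add: L_def add_pos_pos)
  have lip: "norm (\<mu> p a - \<mu> p' a') \<le> L * (norm (p - p') + norm (a - a'))"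
    if pa: "p \<in> ball p0 \<rho>" "a \<in> ball a0 \<rho>" and q: "p' \<in> ball p0 \<rho>" "a' \<in> ball a0 \<rho>" for p a p' a'
  proof (cases "\<mu> p a = \<mu> p' a'")
    case True
    then show ?thesis using Lpos by simp
  next
    case False
    let ?u = "\<mu> p a" and ?u' = "\<mu> p' a'"
    let ?n = "norm (?u - ?u')"
    have ps: "p \<in> cball p0 s" "p' \<in> cball p0 s" using in_cball(1) pa(1) q(1) by blast+
    have us: "?u \<in> cball u0 s" "?u' \<in> cball u0 s" using \<mu>(1)[OF pa] \<mu>(1)[OF q] by auto
    have "b * ?n\<^sup>2 \<le> a \<bullet> (f (p, ?u) - f (p, ?u'))"
      using growth\<mu>[OF pa q refl] by (simp add: inner_diff_right)
    moreover have "b * ?n\<^sup>2 \<le> - (a' \<bullet> (f (p', ?u) - f (p', ?u')))"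
      using growth\<mu>[OF q pa refl] by (simp add: inner_diff_right norm_minus_commute)
    moreover have "c * ?n\<^sup>2 = 2 * (b * ?n\<^sup>2)" by (simp add: c_def)
    ultimately have "c * ?n\<^sup>2 \<le> a \<bullet> (f (p, ?u) - f (p, ?u')) - a' \<bullet> (f (p', ?u) - f (p', ?u'))"
      by linarith
    also have "\<dots> \<le> (Lf * norm (a - a') + B * Lm * norm (p - p')) * ?n"
    proof (rule bilinear_mixed_difference)
      show "norm (f (p, ?u) - f (p, ?u')) \<le> Lf * ?n"
        using Lf(2)[of "(p, ?u)" "(p, ?u')"] ps us by (simp add: norm_Pair)
      show "norm ((f (p, ?u) - f (p, ?u')) - (f (p', ?u) - f (p', ?u'))) \<le> Lm * norm (p - p') * ?n"
        by (rule Lm(2)[OF ps us])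
      show "norm a' \<le> B" by (rule B[OF q(2)])
    qed (use Lm in auto)
    finally have "c * ?n * ?n \<le> (Lf * norm (a - a') + B * Lm * norm (p - p')) * ?n"
      by (simp add: power2_eq_square)
    \<comment> \<open>Both sides contain \<open>?n\<close>, quadratically on the left and linearly
      on the right. Cancelling it turns the energy estimate into a Lipschitz bound.\<close>
    moreover have "?n > 0" using False by simp
    ultimately have "c * ?n \<le> Lf * norm (a - a') + B * Lm * norm (p - p')"
      using mult_le_cancel_right_pos by blast
    also have "\<dots> \<le> (Lf + B * Lm) * norm (a - a') + (Lf + B * Lm) * norm (p - p')"
      using Lf Lm Bp by (intro add_mono mult_right_mono) auto
    finally have "c * ?n \<le> (Lf + B * Lm) * (norm (p - p') + norm (a - a'))"
      by (simp add: algebra_simps)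
    then show ?thesis using c by (simp add: L_def field_simps)
  qed
  show ?thesis
  proof (rule that[of \<rho> s L \<mu>])
    show "\<rho> \<le> R" using \<rho> s by linarith
    show "ball p0 \<rho> \<subseteq> P" using \<rho>1 \<rho> by blast
    show "cball p0 \<rho> \<times> cball u0 s \<subseteq> E" using \<rho>(6) s(4) by blast
    show "\<mu> p a \<in> ball u0 s \<and> M (p, f (p, \<mu> p a)) = 1 \<and>
      (\<forall>v. M (p, v) = 1 \<and> v \<noteq> f (p, \<mu> p a) \<longrightarrow> a \<bullet> v < a \<bullet> f (p, \<mu> p a))"
      if pa: "p \<in> ball p0 \<rho>" "a \<in> ball a0 \<rho>" for p a
      using \<mu>[OF pa] \<omega>[OF pa] opt'[OF pa] by auto
  qed (use \<rho> s Lpos lip in auto)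
qed

section \<open>Charts and bundle coordinates\<close>

context
  fixes A :: "('m::{t2_space, second_countable_topology}, 'n::finite) chart set"
  assumes mfd: "smooth_manifold A"
begin

lemma chart_facts:
  assumes "c \<in> A"
  shows open_chart_domain: "open (fst c)" and open_chart_image: "open (snd c ` fst c)"
    and chart_inv_chart: "x \<in> fst c \<Longrightarrow> chart_inv c (snd c x) = x"
    and chart_chart_inv: "p \<in> snd c ` fst c \<Longrightarrow> snd c (chart_inv c p) = p"
    and chart_inv_in: "p \<in> snd c ` fst c \<Longrightarrow> chart_inv c p \<in> fst c"
    and chart_homeomorphism: "homeomorphism (fst c) (snd c ` fst c) (snd c) (chart_inv c)"
proof -
  have "is_chart c" using mfd assms unfolding smooth_manifold_def by blast
  then show h: "homeomorphism (fst c) (snd c ` fst c) (snd c) (chart_inv c)"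
    and "open (fst c)" "open (snd c ` fst c)" unfolding is_chart_def by auto
  show "x \<in> fst c \<Longrightarrow> chart_inv c (snd c x) = x" "p \<in> snd c ` fst c \<Longrightarrow> snd c (chart_inv c p) = p"
    "p \<in> snd c ` fst c \<Longrightarrow> chart_inv c p \<in> fst c"
    using h unfolding homeomorphism_def by auto
qed

lemma open_chart_image_subset:
  assumes "c \<in> A" "open X"
  shows "open (snd c ` (fst c \<inter> X))"
proof -
  have "openin (top_of_set (snd c ` fst c)) (snd c ` (fst c \<inter> X))"
    by (rule homeomorphism_imp_open_map[OF chart_homeomorphism[OF assms(1)]])
      (use assms in \<open>auto intro: openin_open_Int\<close>)
  then show ?thesis using open_chart_image[OF assms(1)] openin_open_trans by blast
qed

lemma transition_chart:
  "c \<in> A \<Longrightarrow> x \<in> fst c \<Longrightarrow> transition c d (snd c x) = snd d x"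
  by (simp add: transition_def chart_inv_chart)

lemma transition_smooth:
  assumes "c \<in> A" "d \<in> A"
  shows "smooth_on (snd c ` (fst c \<inter> fst d)) (transition c d)"
  using mfd assms unfolding smooth_manifold_def smooth_compatible_def by blast

lemma transition_has_derivative:
  assumes "c \<in> A" "d \<in> A" "x \<in> fst c" "x \<in> fst d"
  shows "(transition c d has_derivative frechet_derivative (transition c d) (at (snd c x))) (at (snd c x))"
  using smooth_on_has_derivative[OF transition_smooth[OF assms(1,2)]] assms(3,4) by blast

text \<open>The chain rule for \<open>transition d g\<close> after \<open>transition c d\<close>,
  which agrees with \<open>transition c g\<close> on the open overlap of the three domains and so
  has the same derivative.\<close>

lemma transition_cocycle:
  assumes "c \<in> A" "d \<in> A" "g \<in> A" "x \<in> fst c" "x \<in> fst d" "x \<in> fst g"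
  shows "frechet_derivative (transition d g) (at (snd d x))
      (frechet_derivative (transition c d) (at (snd c x)) w)
    = frechet_derivative (transition c g) (at (snd c x)) w"
proof -
  let ?X = "snd c ` (fst c \<inter> (fst d \<inter> fst g))"
  have X: "open ?X" "snd c x \<in> ?X"
    using assms by (auto intro!: open_chart_image_subset open_Int open_chart_domain)
  have "((\<lambda>p. transition d g (transition c d p)) has_derivative
      (\<lambda>w. frechet_derivative (transition d g) (at (snd d x))
        (frechet_derivative (transition c d) (at (snd c x)) w))) (at (snd c x))"
    by (rule has_derivative_compose[OF transition_has_derivative])
      (use assms transition_has_derivative[of d g x] in \<open>simp_all add: transition_chart\<close>)
  then have "(transition c g has_derivative
      (\<lambda>w. frechet_derivative (transition d g) (at (snd d x))
        (frechet_derivative (transition c d) (at (snd c x)) w))) (at (snd c x))"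
    by (rule has_derivative_transform_within_open[OF _ X]) (use assms in \<open>auto simp: transition_chart\<close>)
  from frechet_derivative_at[OF this] show ?thesis by metis
qed

lemma transition_self:
  assumes "c \<in> A" "x \<in> fst c"
  shows "frechet_derivative (transition c c) (at (snd c x)) w = w"
proof -
  have "(transition c c has_derivative (\<lambda>w. w)) (at (snd c x))"
    by (rule has_derivative_transform_within_open[OF has_derivative_ident open_chart_image[OF assms(1)]])
      (use assms in \<open>auto simp: transition_chart\<close>)
  from frechet_derivative_at[OF this] show ?thesis by metis
qed

section \<open>Tangent vectors expressed through one chart\<close>

lemma tangent_of_self:
  assumes "c \<in> A" "x \<in> fst c"
  shows "tangent_of A c x w c = w"
  using assms by (simp add: tangent_of_def transition_self)

lemma tangent_of_in_tangent_space:
  assumes "c \<in> A" "x \<in> fst c"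
  shows "tangent_of A c x w \<in> tangent_space A x"
  using assms by (auto simp: tangent_space_def tangent_of_def transition_cocycle)

text \<open>The transformation rule fixes the components in all charts around \<open>x\<close>, and
  the convention fixes the others to 0. So one component recovers the whole function.\<close>

lemma tangent_of_component:
  assumes "c \<in> A" "x \<in> fst c" "v \<in> tangent_space A x"
  shows "tangent_of A c x (v c) = v"
proof
  fix d
  have "d \<in> A \<and> x \<in> fst d \<Longrightarrow> v d = frechet_derivative (transition c d) (at (snd c x)) (v c)"
    "\<not> (d \<in> A \<and> x \<in> fst d) \<Longrightarrow> v d = 0"
    using assms unfolding tangent_space_def by blast+
  then show "tangent_of A c x (v c) d = v d"
    unfolding tangent_of_def by presburger
qed

lemma tangent_of_linear:
  assumes "c \<in> A" "x \<in> fst c"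
  shows tangent_of_add: "tangent_of A c x (w + w') = (\<lambda>d. tangent_of A c x w d + tangent_of A c x w' d)"
    and tangent_of_scaleR: "tangent_of A c x (r *\<^sub>R w) = (\<lambda>d. r *\<^sub>R tangent_of A c x w d)"
proof -
  have "linear (frechet_derivative (transition c d) (at (snd c x)))" if "d \<in> A" "x \<in> fst d" for d
    using transition_has_derivative[OF assms(1) that(1) assms(2) that(2)] has_derivative_linear by blast
  then show "tangent_of A c x (w + w') = (\<lambda>d. tangent_of A c x w d + tangent_of A c x w' d)"
    "tangent_of A c x (r *\<^sub>R w) = (\<lambda>d. r *\<^sub>R tangent_of A c x w d)"
    by (auto simp: tangent_of_def linear_add linear_cmul)
qed

lemma tangent_space_add:
  assumes "v \<in> tangent_space A x" "w \<in> tangent_space A x"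
  shows "(\<lambda>c. v c + w c) \<in> tangent_space A x"
proof -
  obtain c where c: "c \<in> A" "x \<in> fst c" using mfd unfolding smooth_manifold_def by blast
  have "(\<lambda>c. v c + w c) = tangent_of A c x (v c + w c)"
    using assms by (simp add: tangent_of_add[OF c] tangent_of_component[OF c])
  then show ?thesis using tangent_of_in_tangent_space[OF c] by metis
qed

lemma tangent_space_scaleR:
  assumes "v \<in> tangent_space A x"
  shows "(\<lambda>c. r *\<^sub>R v c) \<in> tangent_space A x"
proof -
  obtain c where c: "c \<in> A" "x \<in> fst c" using mfd unfolding smooth_manifold_def by blast
  have "(\<lambda>c. r *\<^sub>R v c) = tangent_of A c x (r *\<^sub>R v c)"
    using assms by (simp add: tangent_of_scaleR[OF c] tangent_of_component[OF c])
  then show ?thesis using tangent_of_in_tangent_space[OF c] by metis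
qed

lemma tangent_space_zero_iff:
  assumes "c \<in> A" "x \<in> fst c" "v \<in> tangent_space A x"
  shows "v = (\<lambda>_. 0) \<longleftrightarrow> v c = 0"
proof
  assume "v c = 0"
  then have "v = tangent_of A c x (0 *\<^sub>R 0)" using tangent_of_component[OF assms] by simp
  then show "v = (\<lambda>_. 0)" unfolding tangent_of_scaleR[OF assms(1,2)] by simp
qed simp

section \<open>Bundle coordinates and covectors\<close>

lemma tb_coords_inv_coords:
  "c \<in> A \<Longrightarrow> x \<in> fst c \<Longrightarrow> v \<in> tangent_space A x \<Longrightarrow> tb_coords_inv A c (snd c x, v c) = (x, v)"
  by (simp add: tb_coords_inv_def chart_inv_chart tangent_of_component)

lemma tb_coords_coords_inv:
  "c \<in> A \<Longrightarrow> p \<in> snd c ` fst c \<Longrightarrow> tb_coords c (tb_coords_inv A c (p, w)) = (p, w)"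
  by (simp add: tb_coords_inv_def tb_coords_def chart_chart_inv tangent_of_self chart_inv_in)

text \<open>Smoothness of a Finsler structure is assumed off the zero section; this translates it
  into smoothness on a product with a punctured vector space, since a tangent vector vanishes as
  soon as one of its components does.\<close>

lemma tb_coords_slit:
  assumes "c \<in> A"
  shows "tb_coords c ` (slit_tangent_bundle A \<inter> over c) = snd c ` fst c \<times> - {0}"
proof (intro equalityI subsetI)
  fix z assume "z \<in> tb_coords c ` (slit_tangent_bundle A \<inter> over c)"
  then show "z \<in> snd c ` fst c \<times> - {0}"
    using tangent_space_zero_iff[OF assms]
    by (auto simp: slit_tangent_bundle_def over_def tb_coords_def)
next
  fix z :: "(real^'n) \<times> (real^'n)" assume "z \<in> snd c ` fst c \<times> - {0}"
  then obtain p and w :: "real^'n" where z: "z = (p, w)" "p \<in> snd c ` fst c" "w \<noteq> 0"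
    by (metis ComplD SigmaE singletonI)
  let ?x = "chart_inv c p"
  have x: "?x \<in> fst c" using chart_inv_in[OF assms z(2)] .
  have "tangent_of A c ?x w \<noteq> (\<lambda>_. 0)"
    using tangent_of_self[OF assms x, of w] z(3) by auto
  then have "tb_coords_inv A c z \<in> slit_tangent_bundle A \<inter> over c"
    using tangent_of_in_tangent_space[OF assms x] x z
    by (simp add: slit_tangent_bundle_def over_def tb_coords_inv_def)
  moreover have "z = tb_coords c (tb_coords_inv A c z)"
    using tb_coords_coords_inv[OF assms z(2)] z(1) by simp
  ultimately show "z \<in> tb_coords c ` (slit_tangent_bundle A \<inter> over c)" by blast
qed

lemma cotangent_eq_sum:
  assumes "c \<in> A" "x \<in> fst c" "\<alpha> \<in> cotangent_space A x" "v \<in> tangent_space A x"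
  shows "\<alpha> v = (\<Sum>i\<in>UNIV. \<alpha> (tangent_of A c x (axis i 1)) * v c $ i)"
proof -
  have lin: "linear (\<lambda>w. \<alpha> (tangent_of A c x w))"
    using assms(3) tangent_of_in_tangent_space[OF assms(1,2)]
    by (intro linearI) (auto simp: tangent_of_add[OF assms(1,2)] tangent_of_scaleR[OF assms(1,2)]
        cotangent_space_def)
  have "\<alpha> (tangent_of A c x (v c)) = (\<Sum>i\<in>UNIV. v c $ i *\<^sub>R \<alpha> (tangent_of A c x (axis i 1)))"
    by (rule bounded_linear_axis_sum) (use lin linear_conv_bounded_linear in blast)
  then show ?thesis by (simp add: tangent_of_component[OF assms(1,2,4)] mult.commute)
qed

lemma ctb_coords_inv_in:
  assumes "c \<in> A" "p \<in> snd c ` fst c"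
  shows "ctb_coords_inv A c (p, a) \<in> cotangent_bundle A"
  using tangent_space_add tangent_space_scaleR
  by (auto simp: ctb_coords_inv_def cotangent_bundle_def cotangent_space_def algebra_simps
      sum.distrib sum_distrib_left)

lemma ctb_coords_inv_coords:
  assumes "c \<in> A" "x \<in> fst c" "\<alpha> \<in> cotangent_space A x"
  shows "ctb_coords_inv A c (ctb_coords A c (x, \<alpha>)) = (x, \<alpha>)"
proof -
  have "(\<lambda>v. if v \<in> tangent_space A x
      then \<Sum>i\<in>UNIV. \<alpha> (tangent_of A c x (axis i 1)) * v c $ i else 0) = \<alpha>"
    using cotangent_eq_sum[OF assms] assms(3) by (auto simp: cotangent_space_def)
  then show ?thesis using assms by (simp add: ctb_coords_inv_def ctb_coords_def chart_inv_chart cong: if_cong)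
qed

lemma ctb_coords_coords_inv:
  assumes "c \<in> A" "p \<in> snd c ` fst c"
  shows "ctb_coords A c (ctb_coords_inv A c (p, a)) = (p, a)"
proof -
  have "(\<Sum>i\<in>UNIV. a $ i * axis j 1 $ i) = a $ j" for j
    by (simp add: axis_def if_distrib cong: if_cong)
  then show ?thesis
    using assms by (simp add: ctb_coords_inv_def ctb_coords_def chart_chart_inv chart_inv_in
        tangent_of_self tangent_of_in_tangent_space vec_eq_iff)
qed

text \<open>Openness in the cotangent bundle is required in every chart \<open>d\<close>, while
  \<open>B\<close> is given in \<open>c\<close>. The image in \<open>d\<close> is a preimage of
  \<open>B\<close> under the change from \<open>d\<close> to \<open>c\<close>, so continuity of that
  change suffices.\<close>

lemma ctb_open_image:
  assumes c: "c \<in> A" and B: "open B" "B \<subseteq> snd c ` fst c \<times> UNIV"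
  shows "ctb_open A (ctb_coords_inv A c ` B)"
  unfolding ctb_open_def
proof (intro conjI ballI)
  show "ctb_coords_inv A c ` B \<subseteq> cotangent_bundle A"
    using ctb_coords_inv_in[OF c] B(2) by blast
next
  fix d assume d: "d \<in> A"
  let ?O = "snd d ` (fst d \<inter> fst c)"
  let ?T = "\<lambda>z. ctb_coords A c (ctb_coords_inv A d z)"
  let ?\<tau> = "transition d c"
  have O: "open (?O \<times> (UNIV :: (real^'n) set))"
    by (intro open_Times open_chart_image_subset[OF d] open_chart_domain[OF c]) simp
  \<comment> \<open>Covector components change by the transposed Jacobian of the opposite
    transition.\<close>
  have T: "?T (q, b) = (?\<tau> q, \<chi> j. \<Sum>i\<in>UNIV.
      b $ i * frechet_derivative (transition c d) (at (?\<tau> q)) (axis j 1) $ i)"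
    if q: "q \<in> ?O" for q b
  proof -
    obtain x where x: "x \<in> fst d" "x \<in> fst c" "q = snd d x" using q by blast
    have "tangent_of A c x w d = frechet_derivative (transition c d) (at (snd c x)) w" for w
      using d x by (simp add: tangent_of_def)
    then show ?thesis unfolding x(3)
      using x by (simp add: ctb_coords_inv_def ctb_coords_def chart_inv_chart[OF d] transition_chart[OF d]
          tangent_of_in_tangent_space[OF c])
  qed
  have cont\<tau>: "continuous_on ?O ?\<tau>"
    by (rule smooth_on_imp_continuous_on[OF transition_smooth[OF d c]])
  have \<tau>im: "?\<tau> ` ?O \<subseteq> snd c ` (fst c \<inter> fst d)"
    by (auto simp: transition_chart[OF d])
  have cont\<tau>1: "continuous_on (?O \<times> UNIV) (\<lambda>z. ?\<tau> (fst z))"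
    by (rule continuous_on_compose2[OF cont\<tau>]) (auto intro!: continuous_intros)
  have contD: "continuous_on (?O \<times> UNIV)
      (\<lambda>z. frechet_derivative (transition c d) (at (?\<tau> (fst z))) (axis j 1))" for j
    by (rule continuous_on_compose2[OF smooth_on_imp_continuous_on[OF
          smooth_on_frechet_derivative[OF transition_smooth[OF c d]]] cont\<tau>1])
      (use \<tau>im in auto)
  have "continuous_on (?O \<times> UNIV) (\<lambda>z. (?\<tau> (fst z), \<chi> j. \<Sum>i\<in>UNIV.
      snd z $ i * frechet_derivative (transition c d) (at (?\<tau> (fst z))) (axis j 1) $ i))"
    by (intro continuous_intros cont\<tau>1 contD)
  then have "continuous_on (?O \<times> UNIV) ?T"
    by (rule continuous_on_eq) (use T in auto)
  then have "open (?T -` B \<inter> ?O \<times> UNIV)"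
    using continuous_on_open_vimage[OF O] B(1) by blast
  moreover have "ctb_coords A d ` (ctb_coords_inv A c ` B \<inter> over d) = ?T -` B \<inter> ?O \<times> UNIV"
  proof (intro equalityI subsetI)
    fix z assume "z \<in> ctb_coords A d ` (ctb_coords_inv A c ` B \<inter> over d)"
    then obtain p a where pa: "(p, a) \<in> B" "ctb_coords_inv A c (p, a) \<in> over d"
      "z = ctb_coords A d (ctb_coords_inv A c (p, a))" by auto
    obtain x \<alpha> where x\<alpha>: "ctb_coords_inv A c (p, a) = (x, \<alpha>)" by fastforce
    have p: "p \<in> snd c ` fst c" using B(2) pa(1) by auto
    have "x \<in> fst c" using x\<alpha> chart_inv_in[OF c p] by (auto simp: ctb_coords_inv_def)
    moreover have "x \<in> fst d" using pa(2) x\<alpha> by (simp add: over_def)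
    moreover have "\<alpha> \<in> cotangent_space A x"
      using ctb_coords_inv_in[OF c p, of a] x\<alpha> by (simp add: cotangent_bundle_def)
    ultimately have "?T z \<in> B" "z \<in> ?O \<times> UNIV"
      using pa x\<alpha> ctb_coords_coords_inv[OF c p, of a] ctb_coords_inv_coords[OF d, of x \<alpha>]
      by (auto simp: ctb_coords_def)
    then show "z \<in> ?T -` B \<inter> ?O \<times> UNIV" by blast
  next
    fix z assume z: "z \<in> ?T -` B \<inter> ?O \<times> UNIV"
    obtain q b where qb: "z = (q, b)" by fastforce
    obtain x \<alpha> where x\<alpha>: "ctb_coords_inv A d z = (x, \<alpha>)" by fastforce
    have q: "q \<in> snd d ` fst d" using z qb by auto
    have x: "x \<in> fst d" "x \<in> fst c"
      using z qb x\<alpha> chart_inv_chart[OF d] by (auto simp: ctb_coords_inv_def)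
    have "\<alpha> \<in> cotangent_space A x"
      using ctb_coords_inv_in[OF d q, of b] x\<alpha> qb by (simp add: cotangent_bundle_def)
    then have "ctb_coords_inv A c (?T z) = (x, \<alpha>)"
      using ctb_coords_inv_coords[OF c x(2)] x\<alpha> by simp
    then have "(x, \<alpha>) \<in> ctb_coords_inv A c ` B \<inter> over d"
      using z x by (force simp: over_def)
    moreover have "z = ctb_coords A d (x, \<alpha>)"
      using ctb_coords_coords_inv[OF d q, of b] x\<alpha> qb by simp
    ultimately show "z \<in> ctb_coords A d ` (ctb_coords_inv A c ` B \<inter> over d)" by blast
  qed
  ultimately show "open (ctb_coords A d ` (ctb_coords_inv A c ` B \<inter> over d))" by simp
qed

end

section \<open>Finsler structures in a chart\<close>

text \<open>Differentiation along a fibre is vertical differentiation on the total space. This links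
  the partial derivatives of the fundamental tensor to \<open>fibre_hessian\<close>.\<close>

lemma partial_deriv_fibre:
  assumes "smooth_on S \<phi>" "(p, y) \<in> S"
  shows "((\<lambda>y. \<phi> (p, y)) has_derivative (\<lambda>v. frechet_derivative \<phi> (at (p, y)) (0, v))) (at y)"
    and "partial_deriv j (\<lambda>y. \<phi> (p, y)) y = frechet_derivative \<phi> (at (p, y)) (0, axis j 1)"
proof -
  show *: "((\<lambda>y. \<phi> (p, y)) has_derivative (\<lambda>v. frechet_derivative \<phi> (at (p, y)) (0, v))) (at y)"
  proof (rule has_derivative_compose[of "\<lambda>y. (p, y)" "\<lambda>v. (0, v)" y UNIV \<phi>])
    show "((\<lambda>y. (p, y)) has_derivative (\<lambda>v. (0, v))) (at y)"
      by (intro has_derivative_Pair has_derivative_const has_derivative_ident)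
    show "(\<phi> has_derivative frechet_derivative \<phi> (at (p, y))) (at (p, y))"
      by (rule smooth_on_has_derivative[OF assms])
  qed
  show "partial_deriv j (\<lambda>y. \<phi> (p, y)) y = frechet_derivative \<phi> (at (p, y)) (0, axis j 1)"
    unfolding partial_deriv_def using frechet_derivative_at[OF *] by metis
qed

lemma fundamental_tensor_quadratic_form:
  fixes \<theta> :: "(real^'n) \<times> (real^'n) \<Rightarrow> real"
  assumes "smooth_on (P \<times> - {0}) \<theta>" "p \<in> P" "w \<noteq> 0"
  shows "v \<bullet> ((\<chi> i j. 1/2 * partial_deriv i (partial_deriv j (\<lambda>y. \<theta> (p, y))) w) *v v)
    = fibre_hessian \<theta> (p, w) v / 2"
proof -
  let ?D = "\<lambda>j z. frechet_derivative \<theta> (at z) (0, axis j 1)"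
  have "partial_deriv i (partial_deriv j (\<lambda>y. \<theta> (p, y))) w
      = frechet_derivative (?D j) (at (p, w)) (0, axis i 1)" for i j
  proof -
    have sm: "smooth_on (P \<times> - {0}) (?D j)"
      by (rule smooth_on_frechet_derivative[OF assms(1)])
    have pw: "(p, w) \<in> P \<times> - {0}" using assms by simp
    have "(\<lambda>y. ?D j (p, y)) differentiable (at w)"
      using partial_deriv_fibre(1)[OF sm pw] differentiable_def by blast
    \<comment> \<open>The first derivatives have been identified away from the origin only; the
      complement of the origin is an open neighbourhood of \<open>w\<close>, so the second
      derivatives agree.\<close>
    then have "frechet_derivative (\<lambda>y. ?D j (p, y)) (at w)
        = frechet_derivative (partial_deriv j (\<lambda>y. \<theta> (p, y))) (at w)"
      by (rule frechet_derivative_transform_within_open[of _ _ "- {0}"])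
        (use assms partial_deriv_fibre(2)[OF assms(1)] in auto)
    then show ?thesis
      using partial_deriv_fibre(2)[OF sm pw, of i] by (simp add: partial_deriv_def)
  qed
  then show ?thesis
    by (simp add: inner_vec_def matrix_vector_mult_def fibre_hessian_def sum_distrib_left
        sum_divide_distrib mult_ac)
qed

text \<open>Exactly the analytic properties that \<open>maximizing_control_lipschitz\<close> asks of
  each \<open>\<Phi> i\<close>.\<close>

lemma finsler_in_chart:
  fixes A :: "('m::{t2_space, second_countable_topology}, 'n::finite) chart set"
  assumes mfd: "smooth_manifold A" and c: "c \<in> A" and F: "finsler_structure A F"
  defines "\<Phi> \<equiv> \<lambda>z. F (tb_coords_inv A c z)"
  shows "continuous_on (snd c ` fst c \<times> UNIV) \<Phi>"
    and "smooth_on (snd c ` fst c \<times> - {0}) \<Phi>"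
    and "p \<in> snd c ` fst c \<Longrightarrow> w \<noteq> 0 \<Longrightarrow> \<Phi> (p, w) > 0"
    and "p \<in> snd c ` fst c \<Longrightarrow> t > 0 \<Longrightarrow> \<Phi> (p, t *\<^sub>R w) = t * \<Phi> (p, w)"
    and "p \<in> snd c ` fst c \<Longrightarrow> w \<noteq> 0 \<Longrightarrow> v \<noteq> 0 \<Longrightarrow> fibre_hessian (\<lambda>z. (\<Phi> z)\<^sup>2) (p, w) v > 0"
proof -
  show "continuous_on (snd c ` fst c \<times> UNIV) \<Phi>"
    using F c unfolding finsler_structure_def tb_continuous_def \<Phi>_def by blast
  have "smooth_on (tb_coords c ` (slit_tangent_bundle A \<inter> over c)) \<Phi>"
    using F c unfolding finsler_structure_def tb_smooth_on_def \<Phi>_def by blast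
  then show sm: "smooth_on (snd c ` fst c \<times> - {0}) \<Phi>"
    by (simp only: tb_coords_slit[OF mfd c])
  have nn: "F (x, v) \<ge> 0 \<and> (F (x, v) = 0 \<longleftrightarrow> v = (\<lambda>_. 0))" if "v \<in> tangent_space A x" for x v
    using F that unfolding finsler_structure_def by blast
  have hm: "F (x, \<lambda>c. r *\<^sub>R v c) = r * F (x, v)" if "v \<in> tangent_space A x" "r > 0" for x v r
    using F that unfolding finsler_structure_def by blast
  {
    assume p: "p \<in> snd c ` fst c"
    let ?x = "chart_inv c p"
    have x: "?x \<in> fst c" by (rule chart_inv_in[OF mfd c p])
    have T: "tangent_of A c ?x w \<in> tangent_space A ?x" for w
      by (rule tangent_of_in_tangent_space[OF mfd c x])
    have Tc: "tangent_of A c ?x w c = w" for w by (rule tangent_of_self[OF mfd c x])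
    have \<Phi>eq: "\<Phi> (p, w) = F (?x, tangent_of A c ?x w)" for w
      by (simp add: \<Phi>_def tb_coords_inv_def)
    show "\<Phi> (p, t *\<^sub>R w) = t * \<Phi> (p, w)" if "t > 0"
      unfolding \<Phi>eq tangent_of_scaleR[OF mfd c x] by (rule hm[OF T that])
    assume w: "w \<noteq> 0"
    have T0: "tangent_of A c ?x w \<noteq> (\<lambda>_. 0)" using Tc[of w] w by auto
    show "\<Phi> (p, w) > 0" using nn[OF T, of w] T0 \<Phi>eq by (simp add: less_le)
    assume v: "v \<noteq> 0"
    have "(?x, tangent_of A c ?x w) \<in> slit_tangent_bundle A"
      using T T0 by (simp add: slit_tangent_bundle_def)
    then have "v \<bullet> (fundamental_tensor A F c ?x (tangent_of A c ?x w) *v v) > 0"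
      using F c x v unfolding finsler_structure_def by blast
    moreover have "fundamental_tensor A F c ?x (tangent_of A c ?x w)
        = (\<chi> i j. 1/2 * partial_deriv i (partial_deriv j (\<lambda>y. (\<Phi> (p, y))\<^sup>2)) w)"
      by (simp add: fundamental_tensor_def Tc \<Phi>eq)
    moreover have "smooth_on (snd c ` fst c \<times> - {0}) (\<lambda>z. (\<Phi> z)\<^sup>2)"
      unfolding power2_eq_square
      by (intro smooth_on_mult sm open_Times open_chart_image[OF mfd c]) (simp add: open_Compl)
    ultimately show "fibre_hessian (\<lambda>z. (\<Phi> z)\<^sup>2) (p, w) v > 0"
      using fundamental_tensor_quadratic_form[of "snd c ` fst c" "\<lambda>z. (\<Phi> z)\<^sup>2" p w v] p w by simp
  }
qed

text \<open>\<open>fibre_differential\<close> is built from derivatives along lines, which need not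
  be linear in the direction. Off the zero section smoothness identifies them with a Frechet
  derivative in a chart, and linearity follows.\<close>

lemma fibre_differential_cotangent:
  fixes A :: "('m::{t2_space, second_countable_topology}, 'n::finite) chart set"
  assumes mfd: "smooth_manifold A" and F: "finsler_structure A F"
    and xv: "(x, v) \<in> slit_tangent_bundle A"
  shows "fibre_differential A F x v \<in> cotangent_space A x"
proof -
  obtain c where c: "c \<in> A" "x \<in> fst c" using mfd unfolding smooth_manifold_def by blast
  define \<Phi> where "\<Phi> z = F (tb_coords_inv A c z)" for z
  have v: "v \<in> tangent_space A x" "v c \<noteq> 0"
    using xv tangent_space_zero_iff[OF mfd c] by (auto simp: slit_tangent_bundle_def)
  have sm: "smooth_on (snd c ` fst c \<times> - {0}) \<Phi>"
    unfolding \<Phi>_def by (rule finsler_in_chart(2)[OF mfd c(1) F])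
  let ?L = "\<lambda>w. frechet_derivative \<Phi> (at (snd c x, v c)) (0, w)"
  have L: "((\<lambda>y. \<Phi> (snd c x, y)) has_derivative ?L) (at (v c))"
    by (rule partial_deriv_fibre(1)[OF sm]) (use c v in auto)
  have "linear ?L" using L has_derivative_linear by blast
  have eq: "fibre_differential A F x v w = ?L (w c)" if w: "w \<in> tangent_space A x" for w
  proof -
    have "(\<lambda>d. v d + t *\<^sub>R w d) \<in> tangent_space A x" for t
      using tangent_space_add[OF mfd v(1) tangent_space_scaleR[OF mfd w]] .
    then have F\<Phi>: "F (x, \<lambda>d. v d + t *\<^sub>R w d) = \<Phi> (snd c x, v c + t *\<^sub>R w c)" for t
      using tb_coords_inv_coords[OF mfd c, of "\<lambda>d. v d + t *\<^sub>R w d"] by (simp add: \<Phi>_def)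
    have "((\<lambda>t. v c + t *\<^sub>R w c) has_derivative (\<lambda>s. s *\<^sub>R w c)) (at 0)"
      by (auto intro!: derivative_eq_intros)
    then have "((\<lambda>t. \<Phi> (snd c x, v c + t *\<^sub>R w c)) has_derivative (\<lambda>s. ?L (s *\<^sub>R w c))) (at 0)"
      by (rule has_derivative_compose) (use L in simp)
    then have "((\<lambda>t. \<Phi> (snd c x, v c + t *\<^sub>R w c)) has_real_derivative ?L (w c)) (at 0)"
      unfolding has_field_derivative_def linear_cmul[OF \<open>linear ?L\<close>]
      by (simp add: mult_commute_abs)
    then show ?thesis using w by (simp add: fibre_differential_def F\<Phi> DERIV_imp_deriv)
  qed
  then show ?thesis
    using tangent_space_add[OF mfd] tangent_space_scaleR[OF mfd]
    by (auto simp: cotangent_space_def linear_add[OF \<open>linear ?L\<close>] linear_cmul[OF \<open>linear ?L\<close>])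
      (simp add: fibre_differential_def)
qed

text \<open>Otherwise the member with index \<open>n + 1\<close> would be a combination of the
  basis, that is, of the first \<open>n\<close> members. The bound ensures that every structure of
  the family occurs among the coordinates of \<open>psi\<close>.\<close>

lemma independent_card_le_dimension:
  fixes k n :: nat
  assumes indep: "covecs_independent {1..k} \<omega>" and basis: "cotangent_basis A x {1..n} \<beta>"
    and eq: "\<And>i. i \<in> {1..k} \<Longrightarrow> \<beta> i = \<omega> i" and cot: "\<And>i. i \<in> {1..k} \<Longrightarrow> \<omega> i \<in> cotangent_space A x"
  shows "k \<le> n"
proof (rule ccontr)
  assume "\<not> k \<le> n"
  then have n: "Suc n \<in> {1..k}" by simp
  obtain r where r: "\<omega> (Suc n) = (\<lambda>w. \<Sum>i\<in>{1..n}. r i * \<beta> i w)"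
    using basis cot[OF n] unfolding cotangent_basis_def by blast
  \<comment> \<open>A dependence relation: the expansion coefficients up to \<open>n\<close>, then
    -1 at \<open>Suc n\<close>, then 0 up to \<open>k\<close>.\<close>
  define s where "s i = (if i \<le> n then r i else if i = Suc n then - 1 else (0::real))" for i
  have "(\<Sum>i\<in>{1..k}. s i * \<omega> i w) = 0" for w
  proof -
    have "(\<Sum>i\<in>{1..k}. s i * \<omega> i w) = (\<Sum>i\<in>{1..Suc n}. s i * \<omega> i w)"
      by (rule sum.mono_neutral_right) (use n in \<open>auto simp: s_def\<close>)
    also have "\<dots> = (\<Sum>i\<in>{1..n}. r i * \<beta> i w) - \<omega> (Suc n) w"
      using n eq by (simp add: s_def)
    finally show ?thesis using fun_cong[OF r, of w] by simp
  qed
  then have "s (Suc n) = 0" using indep n unfolding covecs_independent_def by blast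
  then show False by (simp add: s_def)
qed

text \<open>The components are smooth functions of \<open>(p, \<mu> p a)\<close> on a compact convex
  set, paired with \<open>a\<close>. They inherit the Lipschitz property of \<open>\<mu>\<close>,
  with \<open>E\<close> denoting here the domain of \<open>f\<close>.\<close>

lemma hamiltonian_components_lipschitz:
  fixes f :: "(real^'n) \<times> (real^'n) \<Rightarrow> real^'n" and \<mu> :: "real^'n \<Rightarrow> real^'n \<Rightarrow> real^'n"
  assumes f: "smooth_on E f" and sub: "cball p0 \<rho> \<times> cball u0 s \<subseteq> E" and "L > 0"
    and \<mu>: "\<And>p a. p \<in> ball p0 \<rho> \<Longrightarrow> a \<in> ball a0 \<rho> \<Longrightarrow> \<mu> p a \<in> ball u0 s"
    and lip: "\<And>p a p' a'. \<lbrakk>p \<in> ball p0 \<rho>; a \<in> ball a0 \<rho>; p' \<in> ball p0 \<rho>; a' \<in> ball a0 \<rho>\<rbrakk> \<Longrightarrow>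
      norm (\<mu> p a - \<mu> p' a') \<le> L * (norm (p - p') + norm (a - a'))"
  shows "\<exists>K. K-lipschitz_on (ball p0 \<rho> \<times> ball a0 \<rho>) (\<lambda>(p, a). (f (p, \<mu> p a),
    \<chi> i. - (\<Sum>j\<in>UNIV. a $ j * frechet_derivative f (at (p, \<mu> p a)) (axis i 1, 0) $ j)))"
proof -
  let ?T = "cball p0 \<rho> \<times> cball u0 s"
  let ?D = "\<lambda>i z. frechet_derivative f (at z) (axis i 1, 0)"
  have T: "compact ?T" "convex ?T" by (auto simp: compact_Times convex_Times)
  obtain K0 where K0: "K0 > 0" "\<And>x y. x \<in> ?T \<Longrightarrow> y \<in> ?T \<Longrightarrow> norm (f x - f y) \<le> K0 * norm (x - y)"
    by (rule smooth_on_lipschitz[OF f sub T]) blast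
  have "\<exists>K. K > 0 \<and> (\<forall>x\<in>?T. \<forall>y\<in>?T. norm (?D i x - ?D i y) \<le> K * norm (x - y))" for i
    by (rule smooth_on_lipschitz[OF smooth_on_frechet_derivative[OF f, of "(axis i 1, 0)"] sub T]) auto
  then obtain K where K: "\<And>i. K i > 0" "\<And>i x y. x \<in> ?T \<Longrightarrow> y \<in> ?T \<Longrightarrow> norm (?D i x - ?D i y) \<le> K i * norm (x - y)"
    by metis
  have "\<exists>b>0. \<forall>x\<in>?T. norm (?D i x) \<le> b" for i
  proof -
    have "continuous_on ?T (?D i)"
      by (rule continuous_on_subset[OF smooth_on_imp_continuous_on[OF smooth_on_frechet_derivative[OF f]] sub])
    then have "bounded (?D i ` ?T)"
      using T(1) compact_continuous_image compact_imp_bounded by blast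
    then show ?thesis unfolding bounded_pos by auto
  qed
  then obtain b where b: "\<And>i. b i > 0" "\<And>i x. x \<in> ?T \<Longrightarrow> norm (?D i x) \<le> b i" by metis
  \<comment> \<open>The absolute value keeps \<open>B\<close> nonnegative whatever the sign of
    \<open>\<rho>\<close>.\<close>
  define B where "B = norm a0 + \<bar>\<rho>\<bar>"
  \<comment> \<open>The point \<open>(p, \<mu> p a)\<close> moves by at most
    \<open>norm (p - p')\<close> plus \<open>L\<close> times two distances, each bounded by the
    distance of the pairs.\<close>
  define Q where "Q = 1 + 2 * L"
  \<comment> \<open>The first summand serves the base component. In the sum, \<open>b i\<close>
    covers the change of \<open>a\<close> and \<open>B * (K i * Q)\<close> the change of the
    derivative; the fibre component is measured by its l1 norm.\<close>
  define KK where "KK = K0 * Q + (\<Sum>i\<in>UNIV. b i + B * (K i * Q))"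
  have Bnn: "B \<ge> 0" by (simp add: B_def)
  have Qp: "Q > 0" using \<open>L > 0\<close> by (simp add: Q_def)
  have main: "dist (f (p, \<mu> p a), \<chi> i. - (\<Sum>j\<in>UNIV. a $ j * ?D i (p, \<mu> p a) $ j))
      (f (p', \<mu> p' a'), \<chi> i. - (\<Sum>j\<in>UNIV. a' $ j * ?D i (p', \<mu> p' a') $ j))
      \<le> KK * dist (p, a) (p', a')"
    if pa: "p \<in> ball p0 \<rho>" "a \<in> ball a0 \<rho>" and q: "p' \<in> ball p0 \<rho>" "a' \<in> ball a0 \<rho>" for p a p' a'
  proof -
    let ?d = "norm ((p, a) - (p', a'))"
    let ?x = "(p, \<mu> p a)" and ?y = "(p', \<mu> p' a')"
    have xT: "?x \<in> ?T" "?y \<in> ?T" using \<mu>[OF pa] \<mu>[OF q] pa q by auto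
    have np: "norm (p - p') \<le> ?d" and na: "norm (a - a') \<le> ?d"
      using norm_fst_le[of "p - p'" "a - a'"] norm_snd_le[of "a - a'" "p - p'"] by auto
    have "norm (?x - ?y) \<le> norm (p - p') + norm (\<mu> p a - \<mu> p' a')"
      using norm_Pair_le[of "p - p'" "\<mu> p a - \<mu> p' a'"] by simp
    also have "\<dots> \<le> ?d + L * (?d + ?d)"
      using lip[OF pa q] np na \<open>L > 0\<close>
      by (intro add_mono order_trans[OF lip[OF pa q] mult_left_mono]) auto
    finally have nxy: "norm (?x - ?y) \<le> Q * ?d" by (simp add: Q_def algebra_simps)
    have a'B: "norm a' \<le> B"
      using q(2) norm_triangle_ineq2[of a' a0] by (auto simp: B_def dist_norm norm_minus_commute)
    have m1: "norm (f ?x - f ?y) \<le> K0 * (Q * ?d)"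
      using order_trans[OF K0(2)[OF xT] mult_left_mono[OF nxy]] K0(1) by simp
    have m2: "\<bar>a \<bullet> ?D i ?x - a' \<bullet> ?D i ?y\<bar> \<le> (b i + B * (K i * Q)) * ?d" for i
    proof -
      have "a \<bullet> ?D i ?x - a' \<bullet> ?D i ?y = (a - a') \<bullet> ?D i ?x + a' \<bullet> (?D i ?x - ?D i ?y)"
        by (simp add: inner_diff_left inner_diff_right)
      also have "\<bar>\<dots>\<bar> \<le> norm (a - a') * norm (?D i ?x) + norm a' * norm (?D i ?x - ?D i ?y)"
        using Cauchy_Schwarz_ineq2[of "a - a'" "?D i ?x"] Cauchy_Schwarz_ineq2[of a' "?D i ?x - ?D i ?y"]
        by linarith
      also have "\<dots> \<le> ?d * b i + B * (K i * (Q * ?d))"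
        using na b(2)[OF xT(1), of i] a'B Bnn b(1)[of i]
          order_trans[OF K(2)[OF xT, of i] mult_left_mono[OF nxy]] K(1)[of i]
        by (intro add_mono mult_mono) auto
      finally show ?thesis by (simp add: algebra_simps)
    qed
    have m3: "norm ((\<chi> i. - (a \<bullet> ?D i ?x)) - (\<chi> i. - (a' \<bullet> ?D i ?y)) :: real^'n)
        \<le> (\<Sum>i\<in>UNIV. \<bar>a \<bullet> ?D i ?x - a' \<bullet> ?D i ?y\<bar>)"
      by (rule order_trans[OF norm_le_l1_cart]) (simp add: abs_minus_commute)
    have "norm (f ?x - f ?y) + norm ((\<chi> i. - (a \<bullet> ?D i ?x)) - (\<chi> i. - (a' \<bullet> ?D i ?y)) :: real^'n)
        \<le> K0 * (Q * ?d) + (\<Sum>i\<in>UNIV. (b i + B * (K i * Q)) * ?d)"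
      by (rule add_mono[OF m1 order_trans[OF m3 sum_mono[OF m2]]])
    also have "\<dots> = KK * ?d"
      unfolding KK_def distrib_right sum_distrib_right by (simp add: mult.assoc)
    finally show ?thesis
      using norm_Pair_le[of "f ?x - f ?y" "(\<chi> i. - (a \<bullet> ?D i ?x)) - (\<chi> i. - (a' \<bullet> ?D i ?y)) :: real^'n"]
      by (simp add: dist_norm inner_vec_def)
  qed
  have "KK \<ge> 0" unfolding KK_def using K0 K(1) b(1) Bnn Qp
    by (intro add_nonneg_nonneg sum_nonneg mult_nonneg_nonneg) (auto intro: less_imp_le)
  then have "KK-lipschitz_on (ball p0 \<rho> \<times> ball a0 \<rho>) (\<lambda>(p, a). (f (p, \<mu> p a),
    \<chi> i. - (\<Sum>j\<in>UNIV. a $ j * ?D i (p, \<mu> p a) $ j)))"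
    unfolding lipschitz_on_def using main by auto
  then show ?thesis by blast
qed

section \<open>The extended geodesic field\<close>

lemma unique_maximizer_unique:
  assumes "unique_maximizer S \<alpha> v" "unique_maximizer S \<alpha> w"
  shows "v = w"
proof (rule ccontr)
  assume "v \<noteq> w"
  then have "\<alpha> w < \<alpha> v" using assms unfolding unique_maximizer_def by metis
  moreover have "\<alpha> v < \<alpha> w" using \<open>v \<noteq> w\<close> assms unfolding unique_maximizer_def by metis
  ultimately show False by simp
qed

theorem theorem9p12:
  fixes A :: "('m::{t2_space, second_countable_topology}, 'n::finite) chart set"
    and F G :: "nat \<Rightarrow> 'm \<times> ('m, 'n) tvec \<Rightarrow> real"
    and k :: nat
    and x0 :: 'm and y0 :: "('m, 'n) tvec" and \<alpha>0 :: "('m, 'n) covec"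
    and W V :: "('m \<times> ('m, 'n) tvec) set"
    and c :: "('m, 'n) chart" and e :: "'n \<Rightarrow> nat" and U :: "'m set" and \<epsilon> :: real
    and C :: "(real^'n) set"
  assumes "smooth_manifold A"
    and "1 \<le> k"
    and "\<And>i. i \<in> {1..k} \<Longrightarrow> finsler_structure A (F i)"
    and "tb_open A W" and "(x0, y0) \<in> W"
    and "independent_family_on A F k W"
    and "\<And>i. i \<in> {1..k} \<Longrightarrow> F i (x0, y0) = 1"
    and "\<alpha>0 \<in> cotangent_space A x0" and "\<alpha>0 \<noteq> (\<lambda>_. 0)"
    and "unique_maximizer (unit_sphere A (F_max F k) x0) \<alpha>0 y0"
    and "local_control_system A F k x0 y0 c e G V U \<epsilon>"
    and "C = control_set e G (x0, y0) \<epsilon>"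
  shows "\<exists>N. ctb_open A N \<and> (x0, \<alpha>0) \<in> N \<and> (\<forall>(x, \<alpha>)\<in>N. x \<in> U) \<and>
    (\<forall>(x, \<alpha>)\<in>N. \<exists>!u. is_maximizing_control A (F_max F k) c e G V C x \<alpha> u) \<and>
    lipschitz_field_on A c N (extended_geodesic_field A (F_max F k) c e G V C)"
proof -
  note mfd = assms(1)
  have c: "c \<in> A" "x0 \<in> fst c" and e: "bij_betw e UNIV {1..CARD('n)}"
    and GF: "\<And>i. i \<in> {1..k} \<Longrightarrow> G i = F i"
    and G0: "\<And>i. i \<in> {k<..CARD('n)} \<Longrightarrow> G i (x0, y0) = 1/2"
    and basis: "cotangent_basis A x0 {1..CARD('n)} (\<lambda>i. fibre_differential A (G i) x0 y0)"
    and V: "(x0, y0) \<in> V" "V \<subseteq> over c" "tb_coordinate_system A V (psi c e G)"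
    and U: "open U" "x0 \<in> U" "U \<subseteq> fst c" and \<epsilon>: "0 < \<epsilon>" "\<epsilon> < 1/2"
    and clos: "closure (snd c ` U \<times> control_cube e G (x0, y0) \<epsilon>) \<subseteq> psi c e G ` V"
    using assms(11) unfolding local_control_system_def by auto
  have slit: "(x0, y0) \<in> slit_tangent_bundle A"
    and indep: "covecs_independent {1..k} (\<lambda>i. fibre_differential A (F i) x0 y0)"
    using assms(5,6) unfolding independent_family_on_def by auto
  have y0: "y0 \<in> tangent_space A x0" "y0 c \<noteq> 0"
    using slit tangent_space_zero_iff[OF mfd c] by (auto simp: slit_tangent_bundle_def)
  have kn: "k \<le> CARD('n)"
    by (rule independent_card_le_dimension[OF indep basis])
      (use GF fibre_differential_cotangent[OF mfd assms(3) slit] in auto)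
  define \<psi> where "\<psi> = psi c e G"
  define p0 where "p0 = snd c x0"
  define w0 where "w0 = y0 c"
  define a0 where "a0 = snd (ctb_coords A c (x0, \<alpha>0))"
  define \<Phi> where "\<Phi> i z = F i (tb_coords_inv A c z)" for i z
  define P where "P = snd c ` U"
  define D where "D = tb_coords c ` V"
  define \<Psi> where "\<Psi> z = snd (\<psi> (tb_coords_inv A c z))" for z
  define E where "E = \<psi> ` V"
  define f where "f z = snd (tb_coords c (inv_into V \<psi> z))" for z
  \<comment> \<open>The value of the structure with index \<open>i\<close> is simply a coordinate of
    the control, found through the inverse of \<open>e\<close>; here the constraints lose their
    dependence on the base point.\<close>
  define l where "l i u = u $ inv_into UNIV e i" for i and u :: "real^'n"
  define u0 where "u0 = \<Psi> (p0, w0)"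
  have Vov: "V \<inter> over c = V" using V(2) by blast
  have VT: "\<And>x v. (x, v) \<in> V \<Longrightarrow> x \<in> fst c \<and> v \<in> tangent_space A x"
    and inj: "inj_on \<psi> V" and oE: "open E" and oD: "open D"
    and smpsi: "smooth_on D (\<lambda>z. \<psi> (tb_coords_inv A c z))"
    and sminv: "smooth_on E (\<lambda>z. tb_coords c (inv_into V \<psi> z))"
  proof -
    have "tb_open A V" "inj_on \<psi> V" "open (\<psi> ` V)" "tb_smooth_on A V \<psi>"
      "smooth_on (\<psi> ` (V \<inter> over c)) (\<lambda>z. tb_coords c (inv_into V \<psi> z))"
      using V(3) c(1) unfolding tb_coordinate_system_def \<psi>_def by auto
    then show "inj_on \<psi> V" "open E" "open D" "smooth_on D (\<lambda>z. \<psi> (tb_coords_inv A c z))"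
      "smooth_on E (\<lambda>z. tb_coords c (inv_into V \<psi> z))"
      using c(1) Vov unfolding E_def D_def tb_open_def tb_smooth_on_def by (simp_all, metis+)
    show "x \<in> fst c \<and> v \<in> tangent_space A x" if "(x, v) \<in> V" for x v
      using that V(2) \<open>tb_open A V\<close> unfolding tb_open_def tangent_bundle_def over_def by auto
  qed
  have \<psi>_app: "\<psi> (x, v) = (snd c x, \<chi> j. G (e j) (x, v))" for x v
    by (simp add: \<psi>_def psi_def)
  have sm\<Psi>: "smooth_on D \<Psi>"
    unfolding \<Psi>_def by (rule smooth_on_bounded_linear[OF oD bounded_linear_snd smpsi])
  have smf: "smooth_on E f"
    unfolding f_def by (rule smooth_on_bounded_linear[OF oE bounded_linear_snd sminv])
  have V_D: "(snd c x, v c) \<in> D" "\<Psi> (snd c x, v c) = (\<chi> j. G (e j) (x, v))"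
    "tb_coords_inv A c (snd c x, v c) = (x, v)" if "(x, v) \<in> V" for x v
  proof -
    show "(snd c x, v c) \<in> D" unfolding D_def tb_coords_def using that by force
    show *: "tb_coords_inv A c (snd c x, v c) = (x, v)"
      using tb_coords_inv_coords[OF mfd c(1)] VT[OF that] by blast
    show "\<Psi> (snd c x, v c) = (\<chi> j. G (e j) (x, v))" by (simp add: \<Psi>_def * \<psi>_app)
  qed
  have E_V: "\<exists>x v. (x, v) \<in> V \<and> p = snd c x \<and> u = (\<chi> j. G (e j) (x, v)) \<and> inv_into V \<psi> (p, u) = (x, v) \<and> f (p, u) = v c"
    if pu: "(p, u) \<in> E" for p u
  proof -
    obtain x v where xv: "(x, v) \<in> V" "(p, u) = \<psi> (x, v)" using pu unfolding E_def by auto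
    then have "inv_into V \<psi> (p, u) = (x, v)" using inv_into_f_f[OF inj] by simp
    then show ?thesis using xv by (auto simp: f_def tb_coords_def \<psi>_app)
  qed
  have D_V: "\<exists>x v. (x, v) \<in> V \<and> p = snd c x \<and> w = v c" if "(p, w) \<in> D" for p w
    using that unfolding D_def tb_coords_def by auto
  have f\<Psi>: "(p, \<Psi> (p, w)) \<in> E" "f (p, \<Psi> (p, w)) = w" if pw: "(p, w) \<in> D" for p w
  proof -
    obtain x v where xv: "(x, v) \<in> V" "p = snd c x" "w = v c" using D_V[OF pw] by blast
    then have eq: "(p, \<Psi> (p, w)) = \<psi> (x, v)" using V_D(2)[OF xv(1)] by (simp add: \<psi>_app)
    show "(p, \<Psi> (p, w)) \<in> E" unfolding eq E_def using xv(1) by blast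
    show "f (p, \<Psi> (p, w)) = w"
      unfolding eq f_def using inv_into_f_f[OF inj xv(1)] xv by (simp add: tb_coords_def)
  qed
  have \<Psi>f: "(p, f (p, u)) \<in> D" "\<Psi> (p, f (p, u)) = u" if "(p, u) \<in> E" for p u
    using E_V[OF that] V_D by auto
  have \<Phi>l: "\<Phi> i (p, w) = l i (\<Psi> (p, w))" if i: "i \<in> {1..k}" and pw: "(p, w) \<in> D" for i p w
  proof -
    obtain x v where xv: "(x, v) \<in> V" "p = snd c x" "w = v c" using D_V[OF pw] by blast
    have "i \<in> e ` UNIV" using i kn e by (auto simp: bij_betw_def)
    then have "e (inv_into UNIV e i) = i" by (rule f_inv_into_f)
    then show ?thesis using V_D(2,3)[OF xv(1)] xv GF[OF i] by (simp add: \<Phi>_def l_def)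
  qed
  have P: "open P" "p0 \<in> P" "P \<subseteq> snd c ` fst c"
  proof -
    have "fst c \<inter> U = U" using U(3) by blast
    then show "open P" unfolding P_def using open_chart_image_subset[OF mfd c(1) U(1)] by simp
  qed (use U in \<open>auto simp: P_def p0_def\<close>)
  have M_eq: "Max ((\<lambda>i. \<Phi> i z) ` {1..k}) = F_max F k (tb_coords_inv A c z)" for z
    by (simp add: \<Phi>_def F_max_def)
  have k1: "{1..k} \<noteq> {}" using assms(2) by simp
  have p0w0: "tb_coords_inv A c (p0, w0) = (x0, y0)"
    unfolding p0_def w0_def by (rule tb_coords_inv_coords[OF mfd c y0(1)])
  have Fm0: "F_max F k (x0, y0) = 1"
  proof -
    have "(\<lambda>i. F i (x0, y0)) ` {1..k} = {1}" using assms(7) k1 by auto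
    then show ?thesis by (simp add: F_max_def)
  qed
  have a0: "\<alpha>0 v = a0 \<bullet> v c" if "v \<in> tangent_space A x0" for v
    using cotangent_eq_sum[OF mfd c assms(8) that] by (simp add: a0_def ctb_coords_def inner_vec_def)
  have tbi0: "tb_coords_inv A c (p0, w) = (x0, tangent_of A c x0 w)" for w
    by (simp add: tb_coords_inv_def p0_def chart_inv_chart[OF mfd c])
  have opt: "a0 \<bullet> w < a0 \<bullet> w0" if "F_max F k (tb_coords_inv A c (p0, w)) = 1" "w \<noteq> w0" for w
  proof -
    let ?v = "tangent_of A c x0 w"
    have v: "?v \<in> tangent_space A x0" "?v c = w"
      using tangent_of_in_tangent_space[OF mfd c] tangent_of_self[OF mfd c] by auto
    have "?v \<in> unit_sphere A (F_max F k) x0" using v that by (simp add: unit_sphere_def tbi0)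
    moreover have "?v \<noteq> y0" using v(2) that(2) by (auto simp: w0_def)
    ultimately have "\<alpha>0 ?v < \<alpha>0 y0" using assms(10) unfolding unique_maximizer_def by blast
    then show ?thesis using a0[OF v(1)] a0[OF y0(1)] v(2) by (simp add: w0_def)
  qed
  have fin: "continuous_on (P \<times> UNIV) (\<Phi> i)" "smooth_on (P \<times> - {0}) (\<Phi> i)"
    "\<And>p w. p \<in> P \<Longrightarrow> w \<noteq> 0 \<Longrightarrow> \<Phi> i (p, w) > 0"
    "\<And>p w t. p \<in> P \<Longrightarrow> t > 0 \<Longrightarrow> \<Phi> i (p, t *\<^sub>R w) = t * \<Phi> i (p, w)"
    "\<And>v. v \<noteq> 0 \<Longrightarrow> fibre_hessian (\<lambda>z. (\<Phi> i z)\<^sup>2) (p0, w0) v > 0"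
    if i: "i \<in> {1..k}" for i
  proof -
    note * = finsler_in_chart[OF mfd c(1) assms(3)[OF i], folded \<Phi>_def]
    show "continuous_on (P \<times> UNIV) (\<Phi> i)" "smooth_on (P \<times> - {0}) (\<Phi> i)"
      using continuous_on_subset[OF *(1), of "P \<times> UNIV"] smooth_on_subset[OF _ *(2), of "P \<times> - {0}"] P(3)
      by blast+
    show "\<Phi> i (p, w) > 0" if "p \<in> P" "w \<noteq> 0" for p w
      by (rule *(3)[OF subsetD[OF P(3) that(1)] that(2)])
    show "\<Phi> i (p, t *\<^sub>R w) = t * \<Phi> i (p, w)" if "p \<in> P" "t > 0" for p w t
      by (rule *(4)[OF subsetD[OF P(3) that(1)] that(2)])
    show "fibre_hessian (\<lambda>z. (\<Phi> i z)\<^sup>2) (p0, w0) v > 0" if "v \<noteq> 0" for v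
      by (rule *(5)[OF subsetD[OF P(3,2)] _ that]) (use y0(2) in \<open>simp add: w0_def\<close>)
  qed
  \<comment> \<open>The component vector \<open>a0\<close> is itself read as a tangent vector.
    Rescaled to \<open>F_max = 1\<close> it is a competitor with positive value, and
    \<open>w0\<close> does at least as well.\<close>
  have pos0: "a0 \<bullet> w0 > 0"
  proof -
    have "a0 \<noteq> 0"
    proof
      assume "a0 = 0"
      then have "\<alpha>0 v = 0" for v
        using a0[of v] assms(8) by (cases "v \<in> tangent_space A x0") (auto simp: cotangent_space_def)
      then show False using assms(9) by blast
    qed
    define m where "m = Max ((\<lambda>i. \<Phi> i (p0, a0)) ` {1..k})"
    have "m \<in> (\<lambda>i. \<Phi> i (p0, a0)) ` {1..k}" unfolding m_def by (rule Max_in) (use k1 in auto)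
    then have m0: "m > 0" using fin(3)[OF _ P(2) \<open>a0 \<noteq> 0\<close>] by auto
    have "\<Phi> i (p0, (1 / m) *\<^sub>R a0) = (1 / m) * \<Phi> i (p0, a0)" if "i \<in> {1..k}" for i
      using fin(4)[OF that P(2), of "1 / m" a0] m0 by simp
    then have "(\<lambda>i. \<Phi> i (p0, (1 / m) *\<^sub>R a0)) ` {1..k} = (\<lambda>t. (1 / m) * t) ` ((\<lambda>i. \<Phi> i (p0, a0)) ` {1..k})"
      unfolding image_image by (rule image_cong[OF refl])
    moreover have "mono (\<lambda>t. (1 / m) * t)" using m0 by (intro monoI mult_left_mono) auto
    then have "(1 / m) * m = Max ((\<lambda>t. (1 / m) * t) ` ((\<lambda>i. \<Phi> i (p0, a0)) ` {1..k}))"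
      unfolding m_def by (rule mono_Max_commute) (use k1 in auto)
    ultimately have "Max ((\<lambda>i. \<Phi> i (p0, (1 / m) *\<^sub>R a0)) ` {1..k}) = (1 / m) * m" by simp
    then have "F_max F k (tb_coords_inv A c (p0, (1 / m) *\<^sub>R a0)) = 1" unfolding M_eq using m0 by simp
    then have "a0 \<bullet> ((1 / m) *\<^sub>R a0) \<le> a0 \<bullet> w0"
      using opt[of "(1 / m) *\<^sub>R a0"] by (cases "(1 / m) *\<^sub>R a0 = w0") (simp_all add: less_imp_le)
    moreover have "a0 \<bullet> ((1 / m) *\<^sub>R a0) > 0" using m0 \<open>a0 \<noteq> 0\<close> by simp
    ultimately show ?thesis by linarith
  qed
  have w0n: "w0 \<noteq> 0" using y0(2) by (simp add: w0_def)
  have p0w0D: "(p0, w0) \<in> D" using V_D(1)[OF V(1)] by (simp add: p0_def w0_def)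
  have u0: "u0 = (\<chi> j. G (e j) (x0, y0))" using V_D(2)[OF V(1)] by (simp add: u0_def p0_def w0_def)
  \<comment> \<open>Taking \<open>R = \<epsilon>\<close> keeps the resulting controls inside the
    control cube.\<close>
  obtain \<rho> s L \<mu> where \<rho>: "0 < \<rho>" "s \<le> \<epsilon>" "ball p0 \<rho> \<subseteq> P" "cball p0 \<rho> \<times> cball u0 s \<subseteq> E" "L > 0"
    and \<mu>: "\<And>p a. \<lbrakk>p \<in> ball p0 \<rho>; a \<in> ball a0 \<rho>\<rbrakk> \<Longrightarrow> \<mu> p a \<in> ball u0 s \<and>
      F_max F k (tb_coords_inv A c (p, f (p, \<mu> p a))) = 1 \<and>
      (\<forall>v. F_max F k (tb_coords_inv A c (p, v)) = 1 \<and> v \<noteq> f (p, \<mu> p a) \<longrightarrow> a \<bullet> v < a \<bullet> f (p, \<mu> p a))"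
    and lip: "\<And>p a p' a'. \<lbrakk>p \<in> ball p0 \<rho>; a \<in> ball a0 \<rho>; p' \<in> ball p0 \<rho>; a' \<in> ball a0 \<rho>\<rbrakk> \<Longrightarrow>
      norm (\<mu> p a - \<mu> p' a') \<le> L * (norm (p - p') + norm (a - a'))"
  proof (rule maximizing_control_lipschitz[where \<Phi>=\<Phi> and I="{1..k}" and P=P and ?p0.0=p0 and ?w0.0=w0
        and ?a0.0=a0 and D=D and \<Psi>=\<Psi> and E=E and f=f and l=l and R=\<epsilon>, unfolded M_eq, folded u0_def])
  qed (use k1 P fin w0n p0w0 Fm0 pos0 opt oD p0w0D sm\<Psi> oE smf f\<Psi> \<Psi>f \<Phi>l \<epsilon>(1) in auto)
  define B where "B = ball p0 \<rho> \<times> ball a0 \<rho>"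
  define N where "N = ctb_coords_inv A c ` B"
  have BP: "B \<subseteq> P \<times> UNIV" using \<rho>(3) by (auto simp: B_def)
  have field: "(chart_inv c p, control_field c e G V u (chart_inv c p)) \<in> V"
    "control_field c e G V u (chart_inv c p) c = f (p, u)"
    if pu: "(p, u) \<in> E" and p: "p \<in> snd c ` fst c" for p u
  proof -
    obtain x v where xv: "(x, v) \<in> V" "p = snd c x" "inv_into V \<psi> (p, u) = (x, v)" "f (p, u) = v c"
      using E_V[OF pu] by blast
    have "chart_inv c p = x" using xv VT chart_inv_chart[OF mfd c(1)] by blast
    moreover have "control_field c e G V u (chart_inv c p) = v"
      using xv(3) chart_chart_inv[OF mfd c(1) p] by (simp add: control_field_def \<psi>_def)
    ultimately show "(chart_inv c p, control_field c e G V u (chart_inv c p)) \<in> V"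
      "control_field c e G V u (chart_inv c p) c = f (p, u)" using xv by auto
  qed
  have ctrl: "is_maximizing_control A (F_max F k) c e G V C x \<alpha> u \<longleftrightarrow> u = \<mu> p a"
    if pa: "(p, a) \<in> B" and x\<alpha>: "ctb_coords_inv A c (p, a) = (x, \<alpha>)" for p a x \<alpha> u
  proof -
    have pa': "p \<in> ball p0 \<rho>" "a \<in> ball a0 \<rho>" using pa by (auto simp: B_def)
    have pP: "p \<in> P" using pa' \<rho>(3) by blast
    then have p: "p \<in> snd c ` fst c" using P(3) by blast
    have x: "x = chart_inv c p" using x\<alpha> by (simp add: ctb_coords_inv_def)
    have \<alpha>: "\<alpha> v = a \<bullet> v c" if "v \<in> tangent_space A x" for v
      using x\<alpha> that by (auto simp: ctb_coords_inv_def inner_vec_def)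
    let ?X = "\<lambda>u. control_field c e G V u x"
    have xc: "x \<in> fst c" "snd c x = p"
      using chart_inv_in[OF mfd c(1) p] chart_chart_inv[OF mfd c(1) p] x by auto
    have tbi: "tb_coords_inv A c (p, v c) = (x, v)" if "v \<in> tangent_space A x" for v
      using tb_coords_inv_coords[OF mfd c(1) xc(1) that] xc(2) by simp
    \<comment> \<open>All of \<open>C\<close> has to be covered, not only controls near
      \<open>u0\<close>, because uniqueness of the maximizing control is claimed within
      \<open>C\<close>.\<close>
    have CE: "(p, u) \<in> E" if "u \<in> C" for u
    proof -
      have "(p, u) \<in> snd c ` U \<times> control_cube e G (x0, y0) \<epsilon>"
        using that pP unfolding assms(12) control_set_def P_def by blast
      then show ?thesis unfolding E_def \<psi>_def by (rule subsetD[OF subset_trans[OF closure_subset clos]])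
    qed
    have \<mu>E: "(p, \<mu> p a) \<in> E"
      using \<rho>(4) \<mu>[OF pa'] pa'(1) by auto
    have X: "?X u \<in> tangent_space A x" "?X u c = f (p, u)" if "(p, u) \<in> E" for u
      using field[OF that p] VT x by auto
    have \<mu>C: "\<mu> p a \<in> C"
    proof -
      let ?u = "\<mu> p a"
      have close: "\<bar>?u $ j - G (e j) (x0, y0)\<bar> < \<epsilon>" for j
      proof -
        have "\<bar>(?u - u0) $ j\<bar> \<le> norm (?u - u0)" by (rule component_le_norm_cart)
        also have "\<dots> < \<epsilon>" using \<mu>[OF pa'] \<rho>(2) by (auto simp: dist_norm norm_minus_commute)
        finally show ?thesis by (simp add: u0)
      qed
      then have "?u \<in> control_cube e G (x0, y0) \<epsilon>"
        unfolding control_cube_def by (auto simp: abs_less_iff algebra_simps)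
      \<comment> \<open>Components belonging to the family have maximum exactly 1 and stay positive,
        being within \<open>\<epsilon> < 1/2\<close> of 1. The remaining ones stay within
        \<open>\<epsilon>\<close> of 1/2, strictly between 0 and 1, and cannot affect the
        maximum.\<close>
      moreover have "Max ((\<lambda>j. \<bar>?u $ j\<bar>) ` UNIV) = 1"
      proof -
        have F1: "Max ((\<lambda>i. \<Phi> i (p, f (p, ?u))) ` {1..k}) = 1"
          using \<mu>[OF pa'] unfolding M_eq by blast
        have comp: "\<Phi> (e j) (p, f (p, ?u)) = ?u $ j" if "e j \<in> {1..k}" for j
        proof -
          have "inv_into UNIV e (e j) = j" using e by (simp add: bij_betw_def inv_into_f_f)
          then show ?thesis using \<Phi>l[OF that \<Psi>f(1)[OF \<mu>E]] \<Psi>f(2)[OF \<mu>E] by (simp add: l_def)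
        qed
        have "\<bar>?u $ j\<bar> \<le> 1" for j
        proof (cases "e j \<in> {1..k}")
          case True
          then have "?u $ j \<le> 1" using F1 comp[OF True] k1
            by (metis Max_ge finite_atLeastAtMost finite_imageI imageI)
          moreover have "G (e j) (x0, y0) = 1" using GF[OF True] assms(7)[OF True] by simp
          ultimately show ?thesis using close[of j] \<epsilon> by linarith
        next
          case False
          moreover have "e j \<in> {1..CARD('n)}" using e bij_betwE by blast
          ultimately have "G (e j) (x0, y0) = 1/2" by (intro G0) auto
          then show ?thesis using close[of j] \<epsilon> by linarith
        qed
        moreover have "\<exists>j. \<bar>?u $ j\<bar> = 1"
        proof -
          have "1 \<in> (\<lambda>i. \<Phi> i (p, f (p, ?u))) ` {1..k}"
            unfolding F1[symmetric] by (rule Max_in) (use k1 in auto)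
          then obtain i where i: "i \<in> {1..k}" "\<Phi> i (p, f (p, ?u)) = 1" by auto
          have "i \<in> e ` UNIV" using i(1) kn e by (auto simp: bij_betw_def)
          then obtain j where "i = e j" by blast
          then show ?thesis using comp[of j] i by (intro exI[of _ j]) simp
        qed
        ultimately show ?thesis by (intro Max_eqI) auto
      qed
      ultimately show ?thesis unfolding assms(12) control_set_def by blast
    qed
    have max: "unique_maximizer (unit_sphere A (F_max F k) x) \<alpha> (?X (\<mu> p a))"
      unfolding unique_maximizer_def
    proof (intro conjI ballI impI)
      show "?X (\<mu> p a) \<in> unit_sphere A (F_max F k) x"
        using X[OF \<mu>E] tbi[OF X(1)[OF \<mu>E]] \<mu>[OF pa'] by (simp add: unit_sphere_def)
      fix v assume v: "v \<in> unit_sphere A (F_max F k) x" "v \<noteq> ?X (\<mu> p a)"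
      then have vT: "v \<in> tangent_space A x" and "F_max F k (tb_coords_inv A c (p, v c)) = 1"
        using tbi by (auto simp: unit_sphere_def)
      moreover have "v c \<noteq> f (p, \<mu> p a)"
        using v(2) tbi[OF vT] tbi[OF X(1)[OF \<mu>E]] X(2)[OF \<mu>E] by auto
      ultimately have "a \<bullet> v c < a \<bullet> f (p, \<mu> p a)" using \<mu>[OF pa'] by blast
      then show "\<alpha> v < \<alpha> (?X (\<mu> p a))" using \<alpha>[OF vT] \<alpha>[OF X(1)[OF \<mu>E]] X(2)[OF \<mu>E] by simp
    qed
    show ?thesis
    proof
      assume "u = \<mu> p a"
      then show "is_maximizing_control A (F_max F k) c e G V C x \<alpha> u"
        using \<mu>C max by (simp add: is_maximizing_control_def)
    next
      assume "is_maximizing_control A (F_max F k) c e G V C x \<alpha> u"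
      then have u: "u \<in> C" "unique_maximizer (unit_sphere A (F_max F k) x) \<alpha> (?X u)"
        by (auto simp: is_maximizing_control_def)
      have "?X u = ?X (\<mu> p a)" by (rule unique_maximizer_unique[OF u(2) max])
      \<comment> \<open>Equal vectors have equal controls, since \<open>\<Psi>\<close> recovers the
        control from the vector.\<close>
      then have "f (p, u) = f (p, \<mu> p a)" using X(2)[OF CE[OF u(1)]] X(2)[OF \<mu>E] by metis
      then show "u = \<mu> p a" using \<Psi>f(2)[OF CE[OF u(1)]] \<Psi>f(2)[OF \<mu>E] by metis
    qed
  qed
  have ctb: "ctb_coords A c (ctb_coords_inv A c z) = z" if "z \<in> B" for z
  proof -
    have "fst z \<in> snd c ` fst c" using subsetD[OF BP that] P(3) by (cases z) auto
    then show ?thesis using ctb_coords_coords_inv[OF mfd c(1), of "fst z" "snd z"] by simp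
  qed
  have field_eq: "extended_geodesic_field A (F_max F k) c e G V C (ctb_coords_inv A c (p, a)) =
      (f (p, \<mu> p a), \<chi> i. - (\<Sum>j\<in>UNIV. a $ j * frechet_derivative f (at (p, \<mu> p a)) (axis i 1, 0) $ j))"
    if pa: "(p, a) \<in> B" for p a
  proof -
    obtain x \<alpha> where x\<alpha>: "ctb_coords_inv A c (p, a) = (x, \<alpha>)" by fastforce
    let ?u = "\<mu> p a"
    have pa': "p \<in> ball p0 \<rho>" "a \<in> ball a0 \<rho>" using pa by (auto simp: B_def)
    have THE: "(THE u. is_maximizing_control A (F_max F k) c e G V C x \<alpha> u) = ?u"
      unfolding ctrl[OF pa x\<alpha>] by simp
    \<comment> \<open>The Hamiltonian lift differentiates in the base point with the control frozen
      at \<open>?u\<close>. Only \<open>q \<mapsto> f (q, ?u)\<close> is differentiated, never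
      \<open>\<mu>\<close>, which is merely Lipschitz.\<close>
    have fq: "control_field c e G V ?u (chart_inv c q) c = f (q, ?u)" if "q \<in> ball p0 \<rho>" for q
    proof (rule field(2))
      show "(q, ?u) \<in> E" using \<rho>(4) \<mu>[OF pa'] that by auto
      show "q \<in> snd c ` fst c" using that \<rho>(3) P(3) by blast
    qed
    have pE: "(p, ?u) \<in> E" using \<rho>(4) \<mu>[OF pa'] pa'(1) by auto
    have "partial_deriv i (\<lambda>q. control_field c e G V ?u (chart_inv c q) c $ j) p
        = frechet_derivative f (at (p, ?u)) (axis i 1, 0) $ j" for i j
    proof -
      have "((\<lambda>q. f (q, ?u)) has_derivative (\<lambda>v. frechet_derivative f (at (p, ?u)) (v, 0))) (at p)"
      proof (rule has_derivative_compose[of "\<lambda>q. (q, ?u)" "\<lambda>v. (v, 0)" p UNIV f])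
        show "((\<lambda>q. (q, ?u)) has_derivative (\<lambda>v. (v, 0))) (at p)"
          by (intro has_derivative_Pair has_derivative_const has_derivative_ident)
        show "(f has_derivative frechet_derivative f (at (p, ?u))) (at (p, ?u))"
          by (rule smooth_on_has_derivative[OF smf pE])
      qed
      then have "((\<lambda>q. f (q, ?u) $ j) has_derivative
          (\<lambda>v. frechet_derivative f (at (p, ?u)) (v, 0) $ j)) (at p)"
        by (rule bounded_linear.has_derivative[OF bounded_linear_vec_nth])
      then have "((\<lambda>q. control_field c e G V ?u (chart_inv c q) c $ j) has_derivative
          (\<lambda>v. frechet_derivative f (at (p, ?u)) (v, 0) $ j)) (at p)"
        by (rule has_derivative_transform_within_open[OF _ open_ball pa'(1)]) (simp add: fq)
      from frechet_derivative_at[OF this] show ?thesis unfolding partial_deriv_def by metis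
    qed
    then show ?thesis
      using ctb[OF pa] fq[OF pa'(1)] THE
      by (simp add: extended_geodesic_field_def hamiltonian_lift_def x\<alpha> Let_def)
  qed
  have "ctb_open A N"
    unfolding N_def
  proof (rule ctb_open_image[OF mfd c(1)])
    show "open B" by (simp add: B_def open_Times)
    show "B \<subseteq> snd c ` fst c \<times> UNIV" using BP P(3) by blast
  qed
  moreover have "(x0, \<alpha>0) \<in> N"
  proof -
    have "ctb_coords A c (x0, \<alpha>0) = (p0, a0)" by (simp add: ctb_coords_def p0_def a0_def)
    then have "(x0, \<alpha>0) = ctb_coords_inv A c (p0, a0)"
      using ctb_coords_inv_coords[OF mfd c assms(8)] by simp
    moreover have "(p0, a0) \<in> B" using \<rho>(1) by (simp add: B_def)
    ultimately show ?thesis unfolding N_def by blast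
  qed
  moreover have "\<forall>(x, \<alpha>)\<in>N. x \<in> U"
  proof clarify
    fix x \<alpha> assume "(x, \<alpha>) \<in> N"
    then obtain p a where pa: "(p, a) \<in> B" "(x, \<alpha>) = ctb_coords_inv A c (p, a)" unfolding N_def by auto
    then obtain x' where "x' \<in> U" "p = snd c x'" using BP unfolding P_def by auto
    then show "x \<in> U" using pa(2) chart_inv_chart[OF mfd c(1)] U(3) by (auto simp: ctb_coords_inv_def)
  qed
  moreover have "\<forall>(x, \<alpha>)\<in>N. \<exists>!u. is_maximizing_control A (F_max F k) c e G V C x \<alpha> u"
  proof clarify
    fix x \<alpha> assume "(x, \<alpha>) \<in> N"
    then obtain p a where "(p, a) \<in> B" "ctb_coords_inv A c (p, a) = (x, \<alpha>)" unfolding N_def by auto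
    from ctrl[OF this] show "\<exists>!u. is_maximizing_control A (F_max F k) c e G V C x \<alpha> u" by simp
  qed
  moreover have "lipschitz_field_on A c N (extended_geodesic_field A (F_max F k) c e G V C)"
  proof -
    obtain K where "K-lipschitz_on B (\<lambda>(p, a). (f (p, \<mu> p a),
      \<chi> i. - (\<Sum>j\<in>UNIV. a $ j * frechet_derivative f (at (p, \<mu> p a)) (axis i 1, 0) $ j)))"
      using hamiltonian_components_lipschitz[OF smf \<rho>(4,5) _ lip] \<mu> unfolding B_def by blast
    then have "K-lipschitz_on B
        (\<lambda>z. extended_geodesic_field A (F_max F k) c e G V C (ctb_coords_inv A c z))"
      by (rule lipschitz_on_transform) (auto simp: field_eq)
    moreover have "ctb_coords A c ` N = B"
      unfolding N_def image_image using ctb by simp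
    ultimately show ?thesis unfolding lipschitz_field_on_def by auto
  qed
  ultimately show ?thesis by blast
qed

end
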